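(* There is a sequence of real numbers $(\delta_k)_{k\ge1}$ with $\delta_k\to0$ such that, for all $k$, $$\log\epsilon_k^{inv}\le 2^k\log(C+\delta_k),$$ where $\epsilon_k^{inv}$ and $C$ are as in the context.
   Context: For a positive integer $n$, $\Phi_n(x)=\prod_{1\le j\le n,\ (j,n)=1}(x-e^{2\pi i j/n})=\sum_{m}a_n(m)x^m$ is the $n$-th cyclotomic polynomial, $A_n=\max_m|a_n(m)|$, $S_n=\sum_m|a_n(m)|$. Write $\Psi_n(x)=1/\Phi_n(x)=\sum_{m\ge0}c_n(m)x^m$ as a formal power series and $C_n=\max_m|c_n(m)|$. For distinct odd primes $p_1<\dots<p_k$ put $M_k=\prod_{i=1}^{k-2}p_i^{2^{k-i-1}-1}$. $\epsilon_k$ is the smallest positive real with $A_{p_1\cdots p_k}\le\epsilon_kM_k$ for all odd primes $p_1<\dots<p_k$, and $\epsilon_k^{inv}$ is the smallest positive real with $C_{p_1\cdots p_k}\le\epsilon_k^{inv}M_k$ for all odd primes $p_1<\dots<p_k$. Let $d=\sup_{p<q<r\text{ odd primes}}S_{pqr}/(p^2qr)$, $\rho=\prod_{i=0}^{\infty}\big(\frac{2i+5}{2i+6}\big)^{1/2^i}$ and $C=\big(\tfrac34\epsilon_3^{3/2}d\rho^{1/4}\big)^{1/32}$. *)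

theory Defs
  imports "HOL-Analysis.Analysis" "HOL-Computational_Algebra.Computational_Algebra"
begin

definition cyclo :: "nat \<Rightarrow> complex poly" where
  "cyclo n = (\<Prod>j\<in>{j\<in>{1..n}. coprime j n}. [:- cis (2 * pi * real j / real n), 1:])"

definition cyc_coeff :: "nat \<Rightarrow> nat \<Rightarrow> complex" where
  "cyc_coeff n m = coeff (cyclo n) m"

definition cycA :: "nat \<Rightarrow> real" where
  "cycA n = Max ((\<lambda>m. cmod (cyc_coeff n m)) ` {0..degree (cyclo n)})"

definition cycS :: "nat \<Rightarrow> real" where
  "cycS n = (\<Sum>m\<le>degree (cyclo n). cmod (cyc_coeff n m))"

definition inv_coeff :: "nat \<Rightarrow> nat \<Rightarrow> complex" where
  "inv_coeff n m = fps_nth (inverse (fps_of_poly (cyclo n))) m"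

definition cycC :: "nat \<Rightarrow> real" where
  "cycC n = (SUP m. cmod (inv_coeff n m))"

definition odd_prime_lists :: "nat \<Rightarrow> nat list set" where
  "odd_prime_lists k = {ps. length ps = k \<and> sorted_wrt (<) ps \<and> (\<forall>p\<in>set ps. prime p \<and> odd p)}"

text \<open>M_k = prod_{i=1}^{k-2} p_i^(2^(k-i-1)-1); with 0-based index i, p_{i+1} = ps!i.\<close>
definition Mk :: "nat \<Rightarrow> nat list \<Rightarrow> real" where
  "Mk k ps = (\<Prod>i<k-2. real (ps ! i) ^ (2 ^ (k - i - 2) - 1))"

text \<open>epsilon_k: the smallest positive real e with A_{p1...pk} <= e M_k for all such primes,
  i.e. the supremum of the ratios A/M_k.\<close>
definition eps :: "nat \<Rightarrow> real" where
  "eps k = (SUP ps\<in>odd_prime_lists k. cycA (prod_list ps) / Mk k ps)"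

definition eps_inv :: "nat \<Rightarrow> real" where
  "eps_inv k = (SUP ps\<in>odd_prime_lists k. cycC (prod_list ps) / Mk k ps)"

definition dconst :: real where
  "dconst = (SUP (p,q,r)\<in>{(p,q,r). prime p \<and> prime q \<and> prime r \<and> odd p \<and> 2 < p \<and> p < q \<and> q < r}.
              cycS (p*q*r) / (real p ^ 2 * real q * real r))"

definition rho :: real where
  "rho = (\<Prod>i. ((2 * real i + 5) / (2 * real i + 6)) powr (1 / 2 ^ i))"

definition Cconst :: real where
  "Cconst = (3/4 * eps 3 powr (3/2) * dconst * rho powr (1/4)) powr (1/32)"

end

theory Submission
  imports Defs "HOL-Real_Asymp.Real_Asymp"
begin

text \<open>
  Let \<open>n\<^sub>j = p\<^sub>1 \<cdots> p\<^sub>j\<close>, let \<open>A\<^sub>j\<close>, \<open>S\<^sub>j\<close>, \<open>C\<^sub>j\<close> belong to \<open>n\<^sub>j\<close>, and let \<open>R\<^sub>j\<close> be the polynomial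
  with \<open>\<Phi>(n\<^sub>j) R\<^sub>j = 1 - x^n\<^sub>j\<close>. The identity \<open>\<Phi>\<^sub>m\<^sub>p(x) \<Phi>\<^sub>m(x) = \<Phi>\<^sub>m(x^p)\<close> shows that
  the \<open>\<ell>\<^sup>1\<close>-norm of \<open>R\<^sub>j\<close> is at most \<open>2 S\<^sub>1 \<cdots> S\<^sub>j\<^sub>-\<^sub>1\<close>, and that
  \<open>\<Phi>\<^sub>m\<^sub>p = (\<Phi>\<^sub>m(x^p) / (1 - x^m)) R\<close>, where every coefficient of the first factor is a coefficient of
  \<open>\<Phi>\<^sub>m\<close> or 0 because \<open>deg \<Phi>\<^sub>m < m\<close>. Hence both \<open>A\<^sub>j\<^sub>+\<^sub>1\<close> and \<open>C\<^sub>j\<^sub>+\<^sub>1\<close> are at most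
  \<open>2 A\<^sub>j S\<^sub>1 \<cdots> S\<^sub>j\<^sub>-\<^sub>1\<close>, and counting the terms gives \<open>S\<^sub>j\<^sub>+\<^sub>1 \<le> p\<^sub>j\<^sub>+\<^sub>1 S\<^sub>1 \<cdots> S\<^sub>j\<close>.

  With \<open>s\<^sub>j = S\<^sub>j / (M\<^sub>j n\<^sub>j)\<close> the last bound reads \<open>s\<^sub>j\<^sub>+\<^sub>1 \<le> s\<^sub>1 \<cdots> s\<^sub>j\<close>. Since \<open>s\<^sub>2 \<le> 1/2\<close> and
  \<open>s\<^sub>3 \<le> d\<close>, the products \<open>s\<^sub>1 \<cdots> s\<^sub>j\<close> are at most \<open>d/2\<close> for \<open>j = 3\<close> and are at least squared in each
  further step. Therefore the limit superior of the \<open>2^k\<close>-th roots of the constants is at most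
  \<open>(d/2)^(1/16)\<close>, and this is at most \<open>C\<close> because \<open>d \<le> 1/2\<close>, \<open>\<epsilon>\<^sub>3 \<ge> 1/3\<close> and \<open>\<rho> \<ge> 25/36\<close>.
\<close>

unbundle no vec_syntax

subsection \<open>Cyclotomic polynomials and primitive roots of unity\<close>

text \<open>The exponent ranges over all integers, so that conjugates, powers and roots of elements
  can be named without reducing modulo \<open>n\<close>.\<close>

definition prim_roots :: "nat \<Rightarrow> complex set" where
  "prim_roots n = {z. \<exists>j::int. coprime j (int n) \<and> z = cis (2 * pi * (of_int j / real n))}"

lemma coprime_int_add_mult_iff: "coprime (j + m * k) m \<longleftrightarrow> coprime j (m :: int)"
  by (metis add.commute coprime_iff_gcd_eq_1 gcd.commute gcd_add_mult mult.commute)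

lemma cis_2pi_eq_iff: "cis (2 * pi * r) = cis (2 * pi * s) \<longleftrightarrow> r - s \<in> \<int>"
proof
  assume "cis (2 * pi * r) = cis (2 * pi * s)"
  then have "sin (2 * pi * r) = sin (2 * pi * s) \<and> cos (2 * pi * r) = cos (2 * pi * s)"
    by (simp add: complex_eq_iff)
  then obtain n :: int where "2 * pi * r = 2 * pi * s + 2 * pi * n"
    unfolding sin_cos_eq_iff by blast
  then have "2 * pi * (r - s) = 2 * pi * of_int n" by (simp add: algebra_simps)
  then have "r - s = of_int n" by simp
  then show "r - s \<in> \<int>" by simp
next
  assume "r - s \<in> \<int>"
  then have "cis (2 * pi * (r - s)) = 1" by (rule cis_multiple_2pi)
  moreover have "cis (2 * pi * r) = cis (2 * pi * (r - s)) * cis (2 * pi * s)"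
    by (simp add: cis_mult algebra_simps)
  ultimately show "cis (2 * pi * r) = cis (2 * pi * s)" by simp
qed

lemma cis_2pi_frac_eq_iff:
  assumes "n > 0"
  shows "cis (2 * pi * (of_int i / real n)) = cis (2 * pi * (of_int j / real n)) \<longleftrightarrow> int n dvd i - j"
proof -
  have "real_of_int i / real n - of_int j / real n \<in> \<int> \<longleftrightarrow> int n dvd i - j"
  proof
    assume "real_of_int i / real n - of_int j / real n \<in> \<int>"
    then obtain k where "real_of_int i / real n - of_int j / real n = of_int k"
      by (elim Ints_cases)
    then have "real_of_int (i - j) = real_of_int (int n * k)"
      using assms by (simp add: field_simps)
    then have "i - j = int n * k" by linarith
    then show "int n dvd i - j" by simp
  next
    assume "int n dvd i - j"
    then obtain k where "i - j = int n * k" by (elim dvdE)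
    then have "real_of_int i - of_int j = real n * of_int k"
      by (metis of_int_diff of_int_mult of_int_of_nat_eq)
    then have "real_of_int i / real n - of_int j / real n = of_int k"
      using assms by (simp add: field_simps)
    then show "real_of_int i / real n - of_int j / real n \<in> \<int>" by simp
  qed
  then show ?thesis using cis_2pi_eq_iff by blast
qed

lemma bij_betw_prim_roots:
  assumes "n > 0"
  shows "bij_betw (\<lambda>j. cis (2 * pi * real j / real n)) {j\<in>{1..n}. coprime j n} (prim_roots n)"
proof (rule bij_betw_imageI)
  show "inj_on (\<lambda>j. cis (2 * pi * real j / real n)) {j\<in>{1..n}. coprime j n}"
  proof (rule inj_onI)
    fix i j assume ij: "i \<in> {j\<in>{1..n}. coprime j n}" "j \<in> {j\<in>{1..n}. coprime j n}"
      and eq: "cis (2 * pi * real i / real n) = cis (2 * pi * real j / real n)"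
    from eq have "int n dvd int i - int j"
      using cis_2pi_frac_eq_iff[OF assms, of "int i" "int j"] by simp
    moreover have "\<bar>int i - int j\<bar> < int n" using ij by auto
    ultimately show "i = j" using zdvd_imp_le[of "int n" "\<bar>int i - int j\<bar>"] by force
  qed
  show "(\<lambda>j. cis (2 * pi * real j / real n)) ` {j\<in>{1..n}. coprime j n} = prim_roots n"
  proof (intro equalityI subsetI)
    fix z assume "z \<in> (\<lambda>j. cis (2 * pi * real j / real n)) ` {j\<in>{1..n}. coprime j n}"
    then obtain j where j: "coprime j n" "z = cis (2 * pi * real j / real n)" by auto
    then show "z \<in> prim_roots n"
      unfolding prim_roots_def by (auto intro!: exI[of _ "int j"])
  next
    fix z assume "z \<in> prim_roots n"
    then obtain j where j: "coprime j (int n)" "z = cis (2 * pi * (of_int j / real n))"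
      unfolding prim_roots_def by auto
    \<comment> \<open>The shift by 1 picks the representative of \<open>j\<close> in
      \<open>1..n\<close>, not in \<open>0..n-1\<close>, to match the index set of
      \<open>cyclo\<close>.\<close>
    define i where "i = (j - 1) mod int n + 1"
    have i: "1 \<le> i" "i \<le> int n" using assms unfolding i_def
      by (auto simp: add1_zle_eq)
    have dv: "int n dvd i - j"
    proof -
      have "i - j = (j - 1) mod int n - (j - 1)" by (simp add: i_def)
      moreover have "int n dvd (j - 1) mod int n - (j - 1)" by (simp flip: mod_eq_dvd_iff)
      ultimately show ?thesis by metis
    qed
    then obtain k where "i - j = int n * k" by (elim dvdE)
    then have "i = j + int n * k" by simp
    then have "coprime i (int n)" using j(1) by (simp add: coprime_int_add_mult_iff)
    then have "coprime (nat i) n" using i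
      by (metis coprime_int_iff int_nat_eq order_trans zero_le_one)
    moreover have "z = cis (2 * pi * real (nat i) / real n)"
      using dv i(1) j(2) cis_2pi_frac_eq_iff[OF assms, of i j] by simp
    ultimately show "z \<in> (\<lambda>j. cis (2 * pi * real j / real n)) ` {j\<in>{1..n}. coprime j n}"
      using i by (intro image_eqI[of _ _ "nat i"]) auto
  qed
qed

lemma finite_prim_roots: "n > 0 \<Longrightarrow> finite (prim_roots n)"
  using bij_betw_finite[OF bij_betw_prim_roots] by auto

lemma cyclo_eq_prod_prim_roots:
  assumes "n > 0"
  shows "cyclo n = (\<Prod>z\<in>prim_roots n. [:-z, 1:])"
  unfolding cyclo_def
  using prod.reindex_bij_betw[OF bij_betw_prim_roots[OF assms], of "\<lambda>z. [:-z, 1:]"] by simp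

lemma prim_roots_power:
  assumes "n > 0" "z \<in> prim_roots n"
  shows "z ^ n = 1"
  using assms by (auto simp: prim_roots_def Complex.DeMoivre)

lemma cnj_prim_roots: "z \<in> prim_roots n \<Longrightarrow> cnj z \<in> prim_roots n"
proof -
  assume "z \<in> prim_roots n"
  then obtain j where "coprime j (int n)" "z = cis (2 * pi * (of_int j / real n))"
    unfolding prim_roots_def by auto
  then have "coprime (-j) (int n)" "cnj z = cis (2 * pi * (of_int (-j) / real n))"
    by (simp_all add: cis_cnj)
  then show ?thesis unfolding prim_roots_def by blast
qed

lemma norm_prim_roots: "z \<in> prim_roots n \<Longrightarrow> cmod z = 1"
  by (auto simp: prim_roots_def)

lemma lead_coeff_cyclo [simp]: "lead_coeff (cyclo n) = 1"
  unfolding cyclo_def by (simp add: lead_coeff_prod)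

lemma cyclo_nonzero [simp]: "cyclo n \<noteq> 0"
  using lead_coeff_cyclo[of n] by (metis leading_coeff_0_iff zero_neq_one)

lemma degree_cyclo: "degree (cyclo n) = card {j\<in>{1..n}. coprime j n}"
  unfolding cyclo_def by (simp add: degree_prod_eq_sum_degree)

lemma degree_cyclo_le: "degree (cyclo n) \<le> n"
proof -
  have "card {j\<in>{1..n}. coprime j n} \<le> card {1..n}" by (rule card_mono) auto
  then show ?thesis by (simp add: degree_cyclo)
qed

text \<open>For \<open>n > 1\<close> the index \<open>n\<close> is not coprime to itself. Strictness
  fails at \<open>n = 1\<close>; it later makes exponents up to the degree distinct modulo
  \<open>n\<close>.\<close>

lemma degree_cyclo_less:
  assumes "n > 1"
  shows "degree (cyclo n) < n"
proof -
  have "n \<notin> {j\<in>{1..n}. coprime j n}" "n \<in> {1..n}" using assms by auto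
  then have "{j\<in>{1..n}. coprime j n} \<subset> {1..n}" by blast
  then have "card {j\<in>{1..n}. coprime j n} < card {1..n}" by (intro psubset_card_mono) auto
  then show ?thesis by (simp add: degree_cyclo)
qed

lemma cyclo_1: "cyclo 1 = [:-1, 1:]"
proof -
  have "{j\<in>{1..1}. coprime j 1} = {1::nat}" by auto
  then show ?thesis unfolding cyclo_def by simp
qed

text \<open>The derivative of \<open>x^p - w\<close> vanishes at most at 0, which is not a root, so
  the polynomial is squarefree and splits into distinct linear factors.\<close>

lemma prod_nth_roots:
  assumes "w \<noteq> 0" "p > 0"
  shows "(\<Prod>z | z ^ p = w. [:-z, 1:]) = monom 1 p - [:w::complex:]"
proof -
  define f where "f = monom 1 p - [:w:]"
  have poly_f: "poly f z = z ^ p - w" for z by (simp add: f_def poly_monom)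
  have "rsquarefree f"
    unfolding rsquarefree_roots
  proof (intro allI notI)
    fix a assume a: "poly f a = 0 \<and> poly (pderiv f) a = 0"
    then have "a ^ p = w" using poly_f by simp
    moreover have "of_nat p * a ^ (p - 1) = 0"
      using a by (simp add: f_def pderiv_diff pderiv_monom poly_monom pderiv_pCons)
    ultimately show False using assms by auto
  qed
  from complex_poly_decompose_rsquarefree[OF this]
  have "smult (lead_coeff f) (\<Prod>z | z ^ p = w. [:-z, 1:]) = f"
    by (simp add: poly_f)
  moreover have "lead_coeff f = 1"
  proof -
    have "degree f = p" unfolding f_def using assms
      by (simp add: diff_conv_add_uminus degree_add_eq_left degree_monom_eq del: add_uminus_conv_diff)
    then show ?thesis using assms by (simp add: f_def coeff_pCons split: nat.split)
  qed
  ultimately show ?thesis by (simp add: f_def)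
qed

text \<open>A \<open>p\<close>-th root of a primitive \<open>m\<close>-th root of unity is
  \<open>e(i/(m p))\<close> with \<open>i\<close> coprime to \<open>m\<close>; the two sets
  correspond to \<open>p\<close> not dividing \<open>i\<close> and \<open>p\<close> dividing
  \<open>i\<close>.\<close>

lemma prim_roots_prime_mult:
  assumes p: "prime p" "\<not> p dvd m" and m: "m > 0"
  shows "{z. z ^ p \<in> prim_roots m} = prim_roots (m * p) \<union> prim_roots m" (is "?L = ?A \<union> ?B")
    and "prim_roots (m * p) \<inter> prim_roots m = {}"
proof -
  have p0: "p > 0" using p prime_gt_0_nat by blast
  have cop: "coprime p m" using p prime_imp_coprime by blast
  have pw: "cis (2 * pi * (of_int j / real n)) ^ k = cis (2 * pi * (of_int (j * int k) / real n))"
    for j n k by (simp add: Complex.DeMoivre mult_ac)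
  have pw': "cis (2 * pi * (of_int j / real (m * p))) ^ p = cis (2 * pi * (of_int j / real m))" for j
    using p0 by (simp add: Complex.DeMoivre field_simps)
  show "?L = ?A \<union> ?B"
  proof (intro equalityI subsetI)
    fix z assume "z \<in> ?A \<union> ?B"
    then show "z \<in> ?L"
    proof
      assume "z \<in> ?A"
      then obtain j where "coprime j (int (m * p))" "z = cis (2 * pi * (of_int j / real (m * p)))"
        unfolding prim_roots_def by auto
      then show ?thesis using pw'[of j] unfolding prim_roots_def by auto
    next
      assume "z \<in> ?B"
      then obtain j where j: "coprime j (int m)" "z = cis (2 * pi * (of_int j / real m))"
        unfolding prim_roots_def by auto
      have "coprime (j * int p) (int m)" using j(1) cop by simp
      then show ?thesis using pw[of j m p] j(2) unfolding prim_roots_def by blast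
    qed
  next
    fix z assume "z \<in> ?L"
    then obtain j where j: "coprime j (int m)" "z ^ p = cis (2 * pi * (of_int j / real m))"
      unfolding prim_roots_def by auto
    define y where "y = cis (2 * pi * (of_int j / real (m * p)))"
    have "(z / y) ^ p = 1" using j(2) pw'[of j] by (simp add: y_def power_divide)
    then have "z / y \<in> (\<lambda>k. cis (2 * pi * real k / real p)) ` {..<p}"
      using Complex.bij_betw_roots_unity[OF p0, THEN bij_betw_imp_surj_on] by auto
    then obtain t where t: "t < p" "z / y = cis (2 * pi * real t / real p)" by auto
    \<comment> \<open>The numerator of \<open>z\<close> over \<open>m p\<close>: \<open>y\<close>
      contributes \<open>j\<close> and the \<open>p\<close>-th root of unity \<open>z / y\<close>
      contributes \<open>m t\<close>, which keeps the residue modulo \<open>m\<close>.\<close>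
    define i where "i = j + int m * int t"
    have "z = cis (2 * pi * real t / real p) * y"
      using t(2) by (simp add: y_def field_simps)
    also have "\<dots> = cis (2 * pi * (of_int i / real (m * p)))"
      using p0 m unfolding y_def by (simp add: cis_mult i_def field_simps)
    finally have z: "z = cis (2 * pi * (of_int i / real (m * p)))" .
    have ci: "coprime i (int m)" using j(1) unfolding i_def
      by (simp add: coprime_int_add_mult_iff)
    show "z \<in> ?A \<union> ?B"
    proof (cases "int p dvd i")
      case False
      then have "coprime i (int p)"
        using prime_imp_coprime[of "int p" i] p(1) by (simp add: coprime_commute)
      then have "coprime i (int (m * p))" using ci by simp
      then show ?thesis using z unfolding prim_roots_def by blast
    next
      case True
      then obtain k where k: "i = int p * k" by (elim dvdE)
      have "coprime k (int m)" using ci k by simp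
      moreover have "z = cis (2 * pi * (of_int k / real m))"
        using z k p0 by simp
      ultimately show ?thesis unfolding prim_roots_def by blast
    qed
  qed
  show "?A \<inter> ?B = {}"
  proof (rule ccontr)
    assume "?A \<inter> ?B \<noteq> {}"
    then obtain z where "z \<in> ?A" "z \<in> ?B" by auto
    then obtain j where j: "coprime j (int (m * p))" "z = cis (2 * pi * (of_int j / real (m * p)))"
      unfolding prim_roots_def by auto
    have "z ^ m = 1" using \<open>z \<in> ?B\<close> m prim_roots_power by blast
    moreover have "z ^ m = cis (2 * pi * (of_int j / real p))"
      using j(2) m by (simp add: Complex.DeMoivre field_simps)
    ultimately have "int p dvd j" using cis_2pi_frac_eq_iff[OF p0, of j 0] by simp
    moreover have "coprime j (int p)" using j(1) by simp
    ultimately have "is_unit (int p)" by (metis coprime_common_divisor dvd_refl)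
    then show False using p(1) by auto
  qed
qed

text \<open>Each factor \<open>x^p - w\<close> of the right-hand side splits over the
  \<open>p\<close>-th roots of \<open>w\<close>, and together these roots are the primitive roots of
  orders \<open>m p\<close> and \<open>m\<close>.\<close>

lemma cyclo_mult_prime:
  assumes p: "prime p" "\<not> p dvd m" and m: "m > 0"
  shows "cyclo (m * p) * cyclo m = pcompose (cyclo m) (monom 1 p)"
proof -
  have p0: "p > 0" using p prime_gt_0_nat by blast
  have mp0: "m * p > 0" using m p0 by simp
  have fin: "finite {z::complex. z ^ p = w}" for w using p0 by auto
  have "pcompose (cyclo m) (monom 1 p) = (\<Prod>w\<in>prim_roots m. pcompose [:-w, 1:] (monom 1 p))"
    unfolding cyclo_eq_prod_prim_roots[OF m] by (rule pcompose_prod)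
  also have "\<dots> = (\<Prod>w\<in>prim_roots m. \<Prod>z | z ^ p = w. [:-z, 1:])"
  proof (rule prod.cong[OF refl])
    fix w assume "w \<in> prim_roots m"
    then have "w \<noteq> 0" using norm_prim_roots by fastforce
    then show "pcompose [:-w, 1:] (monom 1 p) = (\<Prod>z | z ^ p = w. [:-z, 1:])"
      using p0 by (simp add: prod_nth_roots pcompose_pCons)
  qed
  also have "\<dots> = (\<Prod>z\<in>(\<Union>w\<in>prim_roots m. {z. z ^ p = w}). [:-z, 1:])"
    by (rule prod.UNION_disjoint[symmetric]) (auto simp: finite_prim_roots m fin)
  also have "(\<Union>w\<in>prim_roots m. {z. z ^ p = w}) = prim_roots (m * p) \<union> prim_roots m"
    using prim_roots_prime_mult(1)[OF p m] by auto
  also have "(\<Prod>z\<in>\<dots>. [:-z, 1:]) = cyclo (m * p) * cyclo m"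
    unfolding cyclo_eq_prod_prim_roots[OF m] cyclo_eq_prod_prim_roots[OF mp0]
    by (rule prod.union_disjoint) (use m mp0 in \<open>simp_all add: finite_prim_roots prim_roots_prime_mult[OF p m] del: mult_pos_pos\<close>)
  finally show ?thesis by simp
qed

text \<open>Reversing the coefficients replaces each root \<open>z\<close> by
  \<open>1/z = cnj z\<close>, which permutes the roots; what remains is a constant of modulus
  1.\<close>

lemma norm_coeff_cyclo_palindromic:
  assumes n: "n > 0" and i: "i \<le> degree (cyclo n)"
  shows "cmod (coeff (cyclo n) (degree (cyclo n) - i)) = cmod (coeff (cyclo n) i)"
proof -
  have "reflect_poly (cyclo n) = (\<Prod>z\<in>prim_roots n. reflect_poly [:-z, 1:])"
    unfolding cyclo_eq_prod_prim_roots[OF n] by (rule reflect_poly_prod)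
  also have "\<dots> = (\<Prod>z\<in>prim_roots n. smult (-z) [:-cnj z, 1:])"
  proof (rule prod.cong[OF refl])
    fix z assume z: "z \<in> prim_roots n"
    then have "z \<noteq> 0" using norm_prim_roots by fastforce
    moreover have "z * cnj z = 1" using norm_prim_roots[OF z] by (simp add: complex_norm_square[symmetric])
    ultimately show "reflect_poly [:-z, 1:] = smult (-z) [:-cnj z, 1:]"
      by (simp add: reflect_poly_pCons)
  qed
  also have "\<dots> = smult (\<Prod>z\<in>prim_roots n. -z) (\<Prod>z\<in>prim_roots n. [:-cnj z, 1:])"
    by (rule prod_smult)
  also have "(\<Prod>z\<in>prim_roots n. [:-cnj z, 1:]) = (\<Prod>z\<in>prim_roots n. [:-z, 1:])"
    by (rule prod.reindex_bij_witness[of _ cnj cnj]) (auto simp: cnj_prim_roots)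
  finally have eq: "reflect_poly (cyclo n) = smult (\<Prod>z\<in>prim_roots n. -z) (cyclo n)"
    by (simp add: cyclo_eq_prod_prim_roots[OF n])
  have "cmod (\<Prod>z\<in>prim_roots n. -z) = 1"
    by (simp add: prod_norm[symmetric] norm_prim_roots)
  then have "cmod (coeff (reflect_poly (cyclo n)) i) = cmod (coeff (cyclo n) i)"
    unfolding eq by (simp add: norm_mult)
  then show ?thesis using i by (simp add: coeff_reflect_poly)
qed

subsection \<open>Coefficient norms\<close>

definition l1_norm :: "complex poly \<Rightarrow> real" where
  "l1_norm f = (\<Sum>i\<le>degree f. cmod (coeff f i))"

lemma l1_norm_nonneg: "l1_norm f \<ge> 0"
  unfolding l1_norm_def by (intro sum_nonneg) auto

lemma l1_norm_eq_sum:
  assumes "degree f \<le> N"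
  shows "l1_norm f = (\<Sum>i\<le>N. cmod (coeff f i))"
  unfolding l1_norm_def using assms
  by (intro sum.mono_neutral_left) (auto simp: coeff_eq_0)

lemma l1_norm_uminus [simp]: "l1_norm (- f) = l1_norm f"
  by (simp add: l1_norm_def)

lemma l1_norm_add_le: "l1_norm (f + g) \<le> l1_norm f + l1_norm g"
proof -
  define N where "N = max (degree f) (degree g)"
  have "degree (f + g) \<le> N" unfolding N_def by (rule degree_add_le_max)
  then have "l1_norm (f + g) = (\<Sum>i\<le>N. cmod (coeff f i + coeff g i))"
    by (simp add: l1_norm_eq_sum)
  also have "\<dots> \<le> (\<Sum>i\<le>N. cmod (coeff f i) + cmod (coeff g i))"
    by (intro sum_mono norm_triangle_ineq)
  also have "\<dots> = l1_norm f + l1_norm g"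
    using l1_norm_eq_sum[of f N] l1_norm_eq_sum[of g N] by (simp add: N_def sum.distrib)
  finally show ?thesis .
qed

lemma l1_norm_monom [simp]: "l1_norm (monom c n) = cmod c"
proof -
  have "l1_norm (monom c n) = (\<Sum>i\<le>n. cmod (coeff (monom c n) i))"
    by (intro l1_norm_eq_sum degree_monom_le)
  also have "\<dots> = (\<Sum>i\<le>n. if i = n then cmod c else 0)"
    by (intro sum.cong) auto
  finally show ?thesis by simp
qed

lemma l1_norm_sum_le: "l1_norm (\<Sum>i\<in>A. f i) \<le> (\<Sum>i\<in>A. l1_norm (f i))"
proof (induction A rule: infinite_finite_induct)
  case (insert x A)
  then show ?case using l1_norm_add_le[of "f x" "\<Sum>i\<in>A. f i"] by simp
qed (simp_all add: l1_norm_def)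

lemma pcompose_monom_eq_sum:
  "pcompose f (monom 1 p) = (\<Sum>i\<le>degree f. monom (coeff f i :: 'a :: comm_ring_1) (i * p))"
proof -
  have pw: "pcompose (g ^ n) q = pcompose g q ^ n" for g q :: "'a poly" and n
    by (induction n) (simp_all add: pcompose_mult pcompose_1)
  have "pcompose f (monom 1 p) = pcompose (\<Sum>i\<le>degree f. monom (coeff f i) i) (monom 1 p)"
    by (simp only: poly_as_sum_of_monoms)
  also have "\<dots> = (\<Sum>i\<le>degree f. monom (coeff f i) (i * p))"
    unfolding pcompose_sum
    by (intro sum.cong refl)
       (simp add: monom_altdef pcompose_smult pw pcompose_pCons power_mult[symmetric] mult.commute)
  finally show ?thesis .
qed

lemma l1_norm_pcompose_monom_le: "l1_norm (pcompose f (monom 1 p)) \<le> l1_norm f"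
proof -
  have "l1_norm (pcompose f (monom 1 p)) \<le> (\<Sum>i\<le>degree f. l1_norm (monom (coeff f i) (i * p)))"
    unfolding pcompose_monom_eq_sum by (rule l1_norm_sum_le)
  then show ?thesis by (simp only: l1_norm_monom l1_norm_def[of f])
qed

text \<open>The range of summation depends on \<open>R\<close> only, so that it can be interchanged
  with a sum over \<open>j\<close>; the guard rules out truncated subtraction.\<close>

lemma fps_mult_poly_nth:
  fixes h :: "'a :: comm_ring_1 fps"
  shows "(h * fps_of_poly R) $ j = (\<Sum>i\<le>degree R. coeff R i * (if i \<le> j then h $ (j - i) else 0))"
proof -
  have "(h * fps_of_poly R) $ j = (\<Sum>i\<le>j. coeff R i * h $ (j - i))"
    by (simp add: mult.commute[of h "fps_of_poly R"] fps_mult_nth atLeast0AtMost)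
  also have "\<dots> = (\<Sum>i\<le>j + degree R. coeff R i * (if i \<le> j then h $ (j - i) else 0))"
    by (intro sum.mono_neutral_cong_left) auto
  also have "\<dots> = (\<Sum>i\<le>degree R. coeff R i * (if i \<le> j then h $ (j - i) else 0))"
    by (intro sum.mono_neutral_right) (auto simp: coeff_eq_0)
  finally show ?thesis .
qed

text \<open>Young's inequality for convolutions, sup norm against l1 norm.\<close>

lemma norm_fps_mult_poly_nth_le:
  assumes "\<And>t. cmod (h $ t) \<le> B"
  shows "cmod ((h * fps_of_poly R) $ j) \<le> B * l1_norm R"
proof -
  have B: "B \<ge> 0" using assms[of 0] norm_ge_zero order_trans by blast
  have "cmod ((h * fps_of_poly R) $ j)
      \<le> (\<Sum>i\<le>degree R. cmod (coeff R i * (if i \<le> j then h $ (j - i) else 0)))"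
    unfolding fps_mult_poly_nth by (rule norm_sum)
  also have "\<dots> \<le> (\<Sum>i\<le>degree R. cmod (coeff R i) * B)"
    using assms B by (intro sum_mono) (auto simp: norm_mult intro!: mult_left_mono)
  finally show ?thesis by (simp add: l1_norm_def sum_distrib_left mult.commute)
qed

text \<open>The l1 analogue. The coefficients of \<open>h\<close> need not be summable, so both
  sides are cut off at \<open>D\<close>; coefficients up to \<open>D\<close> involve
  \<open>h\<close> only up to \<open>D\<close>.\<close>

lemma sum_norm_fps_mult_poly_nth_le:
  "(\<Sum>j\<le>D. cmod ((h * fps_of_poly R) $ j)) \<le> (\<Sum>t\<le>D. cmod (h $ t)) * l1_norm R"
proof -
  have "(\<Sum>j\<le>D. cmod ((h * fps_of_poly R) $ j))
      \<le> (\<Sum>j\<le>D. \<Sum>i\<le>degree R. cmod (coeff R i) * (if i \<le> j then cmod (h $ (j - i)) else 0))"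
    unfolding fps_mult_poly_nth
    by (intro sum_mono sum_norm_le) (auto simp: norm_mult)
  also have "\<dots> = (\<Sum>i\<le>degree R. cmod (coeff R i) * (\<Sum>j\<le>D. if i \<le> j then cmod (h $ (j - i)) else 0))"
    by (subst sum.swap) (simp add: sum_distrib_left)
  also have "\<dots> \<le> (\<Sum>i\<le>degree R. cmod (coeff R i) * (\<Sum>t\<le>D. cmod (h $ t)))"
  proof (rule sum_mono, rule mult_left_mono)
    fix i
    have "(\<Sum>j\<le>D. if i \<le> j then cmod (h $ (j - i)) else 0) = (\<Sum>j\<in>{i..D}. cmod (h $ (j - i)))"
      by (rule sum.mono_neutral_cong_right) auto
    also have "\<dots> = (\<Sum>t\<in>(\<lambda>j. j - i) ` {i..D}. cmod (h $ t))"
      by (subst sum.reindex) (auto simp: inj_on_def)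
    also have "\<dots> \<le> (\<Sum>t\<le>D. cmod (h $ t))"
      by (rule sum_mono2) auto
    finally show "(\<Sum>j\<le>D. if i \<le> j then cmod (h $ (j - i)) else 0) \<le> (\<Sum>t\<le>D. cmod (h $ t))" .
  qed auto
  finally show ?thesis by (simp add: l1_norm_def sum_distrib_left mult.commute)
qed

lemma l1_norm_mult_le: "l1_norm (f * g) \<le> l1_norm f * l1_norm g"
proof -
  define D where "D = degree f + degree g"
  have "l1_norm (f * g) = (\<Sum>j\<le>D. cmod ((fps_of_poly f * fps_of_poly g) $ j))"
    unfolding D_def by (subst l1_norm_eq_sum[OF degree_mult_le]) (simp add: fps_of_poly_mult[symmetric])
  also have "\<dots> \<le> (\<Sum>t\<le>D. cmod (fps_of_poly f $ t)) * l1_norm g"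
    by (rule sum_norm_fps_mult_poly_nth_le)
  also have "(\<Sum>t\<le>D. cmod (fps_of_poly f $ t)) = l1_norm f"
    using l1_norm_eq_sum[of f D] by (simp add: D_def)
  finally show ?thesis .
qed

section \<open>The power series f(x^p) / (1 - x^m), with 1 / (1 - x^m) expanded
  geometrically\<close>

definition geom_fps :: "nat \<Rightarrow> complex fps" where
  "geom_fps m = Abs_fps (\<lambda>i. if m dvd i then 1 else 0)"

lemma geom_fps_mult:
  assumes "m > 0"
  shows "(1 - fps_X ^ m) * geom_fps m = 1"
proof (rule fps_ext)
  fix n
  have "((1 - fps_X ^ m) * geom_fps m) $ n = geom_fps m $ n - (if n < m then 0 else geom_fps m $ (n - m))"
    by (simp add: left_diff_distrib fps_X_power_mult_nth)
  also have "\<dots> = 1 $ n"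
    using assms by (auto simp: geom_fps_def dvd_diff_nat nat_dvd_not_less dest: dvd_diffD1)
       (metis dvd_diffD1 dvd_refl le_add_diff_inverse not_less dvd_add_right_iff)+
  finally show "((1 - fps_X ^ m) * geom_fps m) $ n = 1 $ n" .
qed

lemma stretch_geom_nth:
  "(fps_of_poly (pcompose f (monom 1 p)) * geom_fps m) $ t =
     (\<Sum>i\<le>degree f. if i * p \<le> t \<and> m dvd t - i * p then coeff f i else 0)"
proof -
  have "fps_of_poly (pcompose f (monom 1 p)) * geom_fps m
      = (\<Sum>i\<le>degree f. fps_const (coeff f i) * (fps_X ^ (i * p) * geom_fps m))"
    unfolding pcompose_monom_eq_sum fps_of_poly_sum sum_distrib_right
    by (intro sum.cong refl) (simp add: fps_of_poly_monom mult.assoc)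
  then have "(fps_of_poly (pcompose f (monom 1 p)) * geom_fps m) $ t
      = (\<Sum>i\<le>degree f. coeff f i * (if t < i * p then 0 else geom_fps m $ (t - i * p)))"
    by (simp add: fps_sum_nth fps_X_power_mult_nth)
  also have "\<dots> = (\<Sum>i\<le>degree f. if i * p \<le> t \<and> m dvd t - i * p then coeff f i else 0)"
    by (intro sum.cong refl) (auto simp: geom_fps_def)
  finally show ?thesis .
qed

text \<open>The coefficient at \<open>t\<close> collects those \<open>coeff f i\<close> with
  \<open>i p\<close> congruent to \<open>t\<close> modulo \<open>m\<close>. As \<open>p\<close> is
  invertible modulo \<open>m\<close> and \<open>i \<le> degree f < m\<close>, at most one
  \<open>i\<close> occurs.\<close>

lemma norm_stretch_geom_nth_le:
  assumes "coprime p m" and "degree f < m" and B: "\<And>i. cmod (coeff f i) \<le> B"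
  shows "cmod ((fps_of_poly (pcompose f (monom 1 p)) * geom_fps m) $ t) \<le> B"
proof -
  define I where "I = {i \<in> {..degree f}. i * p \<le> t \<and> m dvd t - i * p}"
  have B0: "B \<ge> 0" using B[of 0] norm_ge_zero order_trans by blast
  have eq: "(fps_of_poly (pcompose f (monom 1 p)) * geom_fps m) $ t = (\<Sum>i\<in>I. coeff f i)"
    unfolding stretch_geom_nth I_def by (rule sum.inter_filter[symmetric]) simp
  have uniq: "i = j" if "i \<in> I" "j \<in> I" for i j
  proof -
    have "int m dvd int t - int i * int p" "int m dvd int t - int j * int p"
      using that unfolding I_def by (auto simp flip: of_nat_mult of_nat_diff)
    then have "int m dvd (int t - int j * int p) - (int t - int i * int p)" by (rule dvd_diff[rotated])
    then have "int m dvd (int i - int j) * int p" by (simp add: algebra_simps)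
    moreover have "coprime (int m) (int p)" using assms(1) by (simp add: coprime_commute)
    ultimately have "int m dvd int i - int j" by (simp add: coprime_dvd_mult_left_iff)
    moreover have "\<bar>int i - int j\<bar> < int m" using that assms(2) unfolding I_def by auto
    ultimately show "i = j" using zdvd_imp_le[of "int m" "\<bar>int i - int j\<bar>"] by force
  qed
  show ?thesis
  proof (cases "I = {}")
    case True
    then show ?thesis using B0 eq by simp
  next
    case False
    then obtain i where "I = {i}" using uniq by blast
    then show ?thesis using B eq by simp
  qed
qed

text \<open>The bound is kept linear in \<open>a\<close> so that it can be averaged later. For
  \<open>D < a \<le> D + m\<close> the set is empty and the right side is still nonnegative.\<close>

lemma card_arith_progression_le:
  assumes "m > 0" and "a \<le> D + m"
  shows "real (card {t \<in> {..D}. a \<le> t \<and> m dvd t - a}) \<le> (real D - real a) / real m + 1"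
proof (cases "a \<le> D")
  case True
  have "{t \<in> {..D}. a \<le> t \<and> m dvd t - a} \<subseteq> (\<lambda>s. a + m * s) ` {..(D - a) div m}"
  proof
    fix t assume "t \<in> {t \<in> {..D}. a \<le> t \<and> m dvd t - a}"
    then obtain s where s: "t \<le> D" "a \<le> t" "t - a = m * s" by auto
    then have "m * s \<le> D - a" by auto
    then have "s \<le> (D - a) div m" using assms(1) by (metis div_le_mono nonzero_mult_div_cancel_left not_less0)
    then show "t \<in> (\<lambda>s. a + m * s) ` {..(D - a) div m}" using s by (intro image_eqI[of _ _ s]) auto
  qed
  from card_mono[OF _ this] have "card {t \<in> {..D}. a \<le> t \<and> m dvd t - a} \<le> card ((\<lambda>s. a + m * s) ` {..(D - a) div m})"
    by auto
  also have "\<dots> \<le> (D - a) div m + 1" using card_image_le[of "{..(D - a) div m}" "\<lambda>s. a + m * s"] by simp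
  finally have "real (card {t \<in> {..D}. a \<le> t \<and> m dvd t - a}) \<le> real ((D - a) div m) + 1" by linarith
  also have "real ((D - a) div m) \<le> real (D - a) / real m" by (rule of_nat_div_le_of_nat)
  finally show ?thesis using True by (simp add: of_nat_diff)
next
  case False
  then have "{t \<in> {..D}. a \<le> t \<and> m dvd t - a} = {}" by auto
  moreover have "real a \<le> real D + real m" using assms(2) by linarith
  then have "0 \<le> (real D - real a) / real m + 1" using assms(1) by (simp add: field_simps)
  ultimately show ?thesis by (simp only: card.empty of_nat_0)
qed

lemma sum_norm_stretch_geom_nth_le:
  assumes "m > 0" and "degree f * p \<le> D + m"
  shows "(\<Sum>t\<le>D. cmod ((fps_of_poly (pcompose f (monom 1 p)) * geom_fps m) $ t))
      \<le> (\<Sum>i\<le>degree f. cmod (coeff f i) * ((real D - real (i * p)) / real m + 1))"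
proof -
  have "(\<Sum>t\<le>D. cmod ((fps_of_poly (pcompose f (monom 1 p)) * geom_fps m) $ t))
      \<le> (\<Sum>t\<le>D. \<Sum>i\<le>degree f. cmod (coeff f i) * (if i * p \<le> t \<and> m dvd t - i * p then 1 else 0))"
    unfolding stretch_geom_nth
    by (intro sum_mono sum_norm_le) auto
  also have "\<dots> = (\<Sum>i\<le>degree f. cmod (coeff f i) * (\<Sum>t\<le>D. if i * p \<le> t \<and> m dvd t - i * p then 1 else 0))"
    by (subst sum.swap) (simp add: sum_distrib_left)
  also have "\<dots> \<le> (\<Sum>i\<le>degree f. cmod (coeff f i) * ((real D - real (i * p)) / real m + 1))"
  proof (rule sum_mono, rule mult_left_mono)
    fix i assume "i \<in> {..degree f}"
    then have "i * p \<le> degree f * p" by simp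
    then have "i * p \<le> D + m" using assms(2) by linarith
    have "(\<Sum>t\<le>D. if i * p \<le> t \<and> m dvd t - i * p then 1 else 0)
        = real (card {t \<in> {..D}. i * p \<le> t \<and> m dvd t - i * p})"
      by (simp add: sum.inter_filter[symmetric])
    then show "(\<Sum>t\<le>D. if i * p \<le> t \<and> m dvd t - i * p then 1 else 0) \<le> (real D - real (i * p)) / real m + 1"
      using card_arith_progression_le[OF assms(1) \<open>i * p \<le> D + m\<close>] by simp
  qed auto
  finally show ?thesis .
qed

subsection \<open>Two prime factors\<close>

lemma cycS_eq_l1_norm: "cycS n = l1_norm (cyclo n)"
  by (simp add: cycS_def l1_norm_def cyc_coeff_def)

lemma norm_coeff_cyclo_le_cycA: "cmod (coeff (cyclo n) i) \<le> cycA n"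
proof -
  have le: "cmod (coeff (cyclo n) i) \<le> cycA n" if "i \<le> degree (cyclo n)" for i
    unfolding cycA_def cyc_coeff_def using that by (intro Max_ge) auto
  show ?thesis
  proof (cases "i \<le> degree (cyclo n)")
    case False
    then have "cmod (coeff (cyclo n) i) = 0" by (simp add: coeff_eq_0)
    also have "0 \<le> cycA n" using le[of 0] norm_ge_zero order_trans by blast
    finally show ?thesis .
  qed (rule le)
qed

lemma cycA_le:
  assumes "\<And>i. cmod (coeff (cyclo n) i) \<le> B"
  shows "cycA n \<le> B"
  unfolding cycA_def cyc_coeff_def using assms by (subst Max_le_iff) auto

lemma cycA_ge_1: "1 \<le> cycA n"
  using norm_coeff_cyclo_le_cycA[of n "degree (cyclo n)"] by simp

lemma cycS_pos: "0 < cycS n"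
proof -
  have "0 < cmod (coeff (cyclo n) (degree (cyclo n)))" by simp
  also have "\<dots> \<le> cycS n" unfolding cycS_def cyc_coeff_def by (rule member_le_sum) auto
  finally show ?thesis .
qed

lemma monom_minus_one_nonzero: "n > 0 \<Longrightarrow> monom 1 n - 1 \<noteq> (0 :: 'a :: comm_ring_1 poly)"
proof
  assume "n > 0" "monom 1 n - 1 = (0 :: 'a poly)"
  then have "coeff (monom 1 n - 1 :: 'a poly) 0 = 0" by (simp only: coeff_0)
  then show False using \<open>n > 0\<close> by simp
qed

lemma pcompose_monom_minus_one:
  "pcompose (monom 1 n - 1 :: complex poly) (monom 1 p) = monom 1 (n * p) - 1"
proof -
  have "pcompose (monom 1 n) (monom 1 p) = (monom 1 (n * p) :: complex poly)"
    by (simp add: pcompose_monom_eq_sum degree_monom_eq if_distrib[of "\<lambda>c. monom c _"] cong: if_cong)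
  then show ?thesis by (simp add: pcompose_diff pcompose_1)
qed

lemma cyclo_prime:
  assumes "prime p"
  shows "cyclo p = (\<Sum>i<p. monom 1 i)"
proof -
  have X: "[:-1, 1:] = (monom 1 1 - 1 :: complex poly)" by (simp add: monom_altdef one_pCons)
  have "cyclo p * [:-1, 1:] = pcompose [:-1, 1:] (monom 1 p)"
    using cyclo_mult_prime[of p 1] assms prime_gt_1_nat[OF assms]
    unfolding cyclo_1 by (simp only: mult_1) (metis less_irrefl nat_dvd_1_iff_1 zero_less_one)
  also have "pcompose [:-1, 1:] (monom 1 p) = pcompose (monom 1 1 - 1 :: complex poly) (monom 1 p)" by (simp only: X)
  also have "pcompose (monom 1 1 - 1) (monom 1 p) = (monom 1 p - 1 :: complex poly)"
    by (subst pcompose_monom_minus_one) simp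
  also have "\<dots> = (\<Sum>i<p. monom 1 i) * (monom 1 1 - 1)"
    using power_diff_1_eq[of "monom 1 1 :: complex poly" p]
    by (simp add: monom_power mult.commute)
  finally show ?thesis unfolding X
    using mult_right_cancel[OF monom_minus_one_nonzero[OF zero_less_one, where ?'a = complex]] by blast
qed

lemma cycA_prime_le: "prime p \<Longrightarrow> cycA p \<le> 1"
  by (intro cycA_le) (auto simp: cyclo_prime coeff_sum)

lemma l1_norm_geometric: "l1_norm (\<Sum>i<n. monom 1 (i * m)) \<le> real n"
  by (rule order_trans[OF l1_norm_sum_le]) simp

lemma sum_monom_mult:
  "(\<Sum>i<n. monom 1 (i * m)) * (monom 1 m - 1) = (monom 1 (n * m) - 1 :: complex poly)"
  using power_diff_1_eq[of "monom 1 m :: complex poly" n] by (simp add: monom_power mult.commute)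

text \<open>With \<open>u p + v q = p q + 1\<close> one has
  \<open>\<Phi>\<^sub>p\<^sub>q = U V - x U' V'\<close> for geometric sums with \<open>u\<close>, \<open>v\<close>, \<open>q - u\<close>, \<open>p - v\<close> terms.\<close>

lemma cycS_two_primes_le:
  assumes "prime p" "prime q" "p \<noteq> q"
  shows "cycS (p * q) \<le> real p * real q / 2"
proof -
  let ?X = "\<lambda>n. monom 1 n :: complex poly"
  have p: "p > 1" and q: "q > 1" using assms prime_gt_1_nat by auto
  have cop: "coprime p q" using assms by (simp add: primes_coprime)
  obtain u v where uv: "u * p + v * q = p * q + 1" "u \<le> q" "v \<le> p"
  proof -
    obtain x y where xy: "p * x = q * y + 1"
      using bezout_nat[of p q] cop p by auto
    \<comment> \<open>\<open>u\<close> is the inverse of \<open>p\<close> modulo \<open>q\<close>;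
      from \<open>p u = q z + 1\<close> the choice \<open>v = p - z\<close> follows.\<close>
    define u z where "u = x mod q" and "z = p * u div q"
    have "p * u mod q = 1"
    proof -
      have "p * u mod q = p * x mod q" unfolding u_def by (rule mod_mult_right_eq)
      moreover have "(q * y + 1) mod q = 1 mod q" by (rule mod_mult_self4)
      ultimately show ?thesis unfolding xy using q by simp
    qed
    then have pu: "p * u = q * z + 1" using mult_div_mod_eq[of q "p * u"] by (simp add: z_def)
    have u: "u < q" unfolding u_def using q by simp
    then have "p * u < p * q" using p by simp
    then have "q * z < q * p" using pu unfolding mult.commute[of q p] by linarith
    then have z: "z < p" using q by (simp only: mult_less_cancel1)
    have "(p - z) * q + z * q = p * q" using z by (simp flip: distrib_right)
    then have "u * p + (p - z) * q = p * q + 1" using pu by (simp add: mult.commute)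
    then show thesis using that[of u "p - z"] u by simp
  qed
  define U V U' V' where "U = (\<Sum>i<u. ?X (i * p))" and "V = (\<Sum>i<v. ?X (i * q))"
    and "U' = (\<Sum>i<q - u. ?X (i * p))" and "V' = (\<Sum>i<p - v. ?X (i * q))"
  have U: "U * (?X p - 1) = ?X (u * p) - 1" "U' * (?X p - 1) = ?X ((q - u) * p) - 1"
    and V: "V * (?X q - 1) = ?X (v * q) - 1" "V' * (?X q - 1) = ?X ((p - v) * q) - 1"
    unfolding U_def V_def U'_def V'_def by (rule sum_monom_mult)+
  \<comment> \<open>The two sides are compared after multiplication by
    \<open>(x^p - 1) (x^q - 1)\<close>: both products equal
    \<open>(x^(p q) - 1) (x - 1)\<close>.\<close>
  have "cyclo (p * q) * cyclo p * (?X 1 - 1) * (?X q - 1)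
      = pcompose (cyclo p) (?X q) * (?X 1 - 1) * (?X q - 1)"
    using cyclo_mult_prime[of q p] assms p primes_dvd_imp_eq[of q p] by auto
  also have "cyclo (p * q) * cyclo p * (?X 1 - 1) * (?X q - 1)
      = cyclo (p * q) * (cyclo p * (?X 1 - 1)) * (?X q - 1)" by (simp only: mult.assoc)
  also have "cyclo p * (?X 1 - 1) = ?X p - 1"
    using sum_monom_mult[where n = p and m = 1] unfolding cyclo_prime[OF assms(1)] mult_1_right .
  also have "pcompose (cyclo p) (?X q) * (?X 1 - 1) * (?X q - 1)
      = pcompose (cyclo p) (?X q) * pcompose (?X 1 - 1) (?X q) * (?X 1 - 1)"
    by (subst pcompose_monom_minus_one) simp
  also have "\<dots> = pcompose (cyclo p * (?X 1 - 1)) (?X q) * (?X 1 - 1)" by (simp only: pcompose_mult)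
  also have "cyclo p * (?X 1 - 1) = ?X p - 1"
    using sum_monom_mult[where n = p and m = 1] unfolding cyclo_prime[OF assms(1)] mult_1_right .
  also have "pcompose (?X p - 1) (?X q) = ?X (p * q) - 1" by (rule pcompose_monom_minus_one)
  finally have A: "cyclo (p * q) * (?X p - 1) * (?X q - 1) = (?X (p * q) - 1) * (?X 1 - 1)" .
  have "(U * V - ?X 1 * U' * V') * (?X p - 1) * (?X q - 1)
      = (U * (?X p - 1)) * (V * (?X q - 1)) - ?X 1 * (U' * (?X p - 1)) * (V' * (?X q - 1))"
    by algebra
  also have "\<dots> = (?X (u * p) - 1) * (?X (v * q) - 1) - ?X 1 * (?X ((q - u) * p) - 1) * (?X ((p - v) * q) - 1)"
    unfolding U V ..
  also have "\<dots> = (?X (p * q) - 1) * (?X 1 - 1)"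
  proof -
    have e: "(q - u) * p + u * p = p * q" "(p - v) * q + v * q = p * q"
      using uv by (simp_all add: distrib_right[symmetric])
    have n: "u * p + v * q = p * q + 1" "1 + (q - u) * p = v * q" "1 + (p - v) * q = u * p"
      "1 + ((q - u) * p + (p - v) * q) = p * q" using e uv by linarith+
    have "?X (u * p) * ?X (v * q) = ?X (p * q) * ?X 1" "?X 1 * ?X ((q - u) * p) = ?X (v * q)"
      "?X 1 * ?X ((p - v) * q) = ?X (u * p)" "?X 1 * (?X ((q - u) * p) * ?X ((p - v) * q)) = ?X (p * q)"
      by (simp_all only: mult_monom n mult_1)
    then show ?thesis by algebra
  qed
  finally have "cyclo (p * q) * (?X p - 1) * (?X q - 1) = (U * V - ?X 1 * U' * V') * (?X p - 1) * (?X q - 1)"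
    using A by simp
  then have eq: "cyclo (p * q) = U * V + - (?X 1 * U' * V')"
    using monom_minus_one_nonzero[of p, where ?'a = complex] monom_minus_one_nonzero[of q, where ?'a = complex] p q by simp
  have "cycS (p * q) \<le> l1_norm (U * V) + l1_norm (?X 1 * U' * V')"
    unfolding cycS_eq_l1_norm eq by (rule order_trans[OF l1_norm_add_le]) simp
  also have "\<dots> \<le> l1_norm U * l1_norm V + 1 * l1_norm U' * l1_norm V'"
    by (intro add_mono l1_norm_mult_le order_trans[OF l1_norm_mult_le mult_right_mono])
       (auto simp: l1_norm_nonneg intro: order_trans[OF l1_norm_mult_le])
  also have "\<dots> \<le> real u * real v + 1 * real (q - u) * real (p - v)"
    unfolding U_def V_def U'_def V'_def
    by (intro add_mono mult_mono l1_norm_geometric mult_nonneg_nonneg) (auto simp: l1_norm_nonneg)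
  also have "\<dots> = of_int (int u * int v + (int q - int u) * (int p - int v))"
    using uv by (simp add: of_nat_diff)
  also have "\<dots> \<le> real p * real q / 2"
  proof -
    \<comment> \<open>Since \<open>x + y = P + 1\<close>, one gets
      \<open>2 P b = 4 x y - 2 P \<le> (x + y)^2 - 2 P = P^2 + 1\<close>. This is below
      \<open>P (P + 1)\<close>, and integrality of \<open>b\<close> removes the excess.\<close>
    define P b x y where "P = int p * int q" and "b = int u * int v + (int q - int u) * (int p - int v)"
      and "x = int u * int p" and "y = int v * int q"
    have P: "P > 0" unfolding P_def using p q by simp
    have xy: "x + y = P + 1" unfolding x_def y_def P_def using uv(1) by (metis of_nat_1 of_nat_add of_nat_mult)
    have "P * (2 * b) = 2 * (x * y + (P - x) * (P - y))"
      unfolding P_def b_def x_def y_def by (simp add: algebra_simps)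
    also have "\<dots> = 4 * (x * y) - 2 * P"
    proof -
      have "(P - x) * (P - y) = P * P - P * (x + y) + x * y" by (simp add: algebra_simps)
      then show ?thesis unfolding xy by (simp add: algebra_simps)
    qed
    also have "4 * (x * y) \<le> (x + y)\<^sup>2"
      using zero_le_power2[of "x - y"] by (simp add: power2_eq_square algebra_simps)
    also have "(x + y)\<^sup>2 - 2 * P = P * P + 1" unfolding xy by (simp add: power2_eq_square algebra_simps)
    finally have "P * (2 * b) \<le> P * P + 1" by simp
    moreover have "P > 1" unfolding P_def using p q by (metis less_1_mult of_nat_1 of_nat_less_iff)
    ultimately have "P * (2 * b) < P * (P + 1)" by (simp add: algebra_simps)
    then have "2 * b \<le> P" using P by (simp add: mult_less_cancel_left_pos)
    then have "2 * real_of_int b \<le> real_of_int P" by linarith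
    then show ?thesis unfolding b_def P_def by simp
  qed
  finally show ?thesis .
qed

subsection \<open>Adjoining one prime at a time\<close>

locale prime_seq =
  fixes p :: "nat \<Rightarrow> nat" and k :: nat
  assumes prime_p: "i < k \<Longrightarrow> prime (p i)"
    and inj_p: "inj_on p {..<k}"
begin

definition N :: "nat \<Rightarrow> nat" where "N j = (\<Prod>i<j. p i)"

text \<open>The cofactor \<open>(1 - x^(N j)) / cyclo (N j)\<close>, given as a product so that its
  l1 norm can be bounded factor by factor. It starts at \<open>-1\<close> because
  \<open>cyclo 1 = x - 1\<close>.\<close>

primrec R :: "nat \<Rightarrow> complex poly" where
  "R 0 = - 1"
| "R (Suc j) = cyclo (N j) * pcompose (R j) (monom 1 (p j))"

lemma N_0 [simp]: "N 0 = 1" and N_Suc [simp]: "N (Suc j) = N j * p j"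
  by (simp_all add: N_def)

lemma p_gt_1: "i < k \<Longrightarrow> p i > 1"
  using prime_p prime_gt_1_nat by blast

lemma N_pos: "j \<le> k \<Longrightarrow> N j > 0"
proof -
  assume "j \<le> k"
  then have "0 < p i" if "i \<in> {..<j}" for i using p_gt_1[of i] that by auto
  then show ?thesis unfolding N_def by (intro prod_pos) blast
qed

lemma not_dvd_N: "j < k \<Longrightarrow> \<not> p j dvd N j"
proof
  assume j: "j < k" and "p j dvd N j"
  then obtain i where i: "i < j" "p j dvd p i"
    unfolding N_def using prime_dvd_prod_iff[of "{..<j}" "p j" p] prime_p by auto
  then have "p j = p i" using j prime_p by (intro primes_dvd_imp_eq) auto
  then show False using inj_onD[OF inj_p, of j i] i j by auto
qed

lemma N_gt_1: "1 \<le> j \<Longrightarrow> j \<le> k \<Longrightarrow> N j > 1"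
proof -
  assume j: "1 \<le> j" "j \<le> k"
  then obtain i where i: "j = Suc i" "i < k" by (cases j) auto
  then have "N i \<ge> 1" "p i > 1" using N_pos[of i] p_gt_1 by auto
  then show ?thesis using i by (metis N_Suc less_1_mult mult_1 nat_less_le)
qed

lemma cyclo_N_Suc:
  "j < k \<Longrightarrow> cyclo (N (Suc j)) * cyclo (N j) = pcompose (cyclo (N j)) (monom 1 (p j))"
  using cyclo_mult_prime[OF prime_p not_dvd_N N_pos] by simp

text \<open>Substituting \<open>x^(p j)\<close> for \<open>x\<close> in the identity for
  \<open>j\<close> gives the one for \<open>Suc j\<close>, by \<open>cyclo_N_Suc\<close>.\<close>

lemma cyclo_mult_R: "j \<le> k \<Longrightarrow> cyclo (N j) * R j = 1 - monom 1 (N j)"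
proof (induction j)
  case 0
  then show ?case by (simp add: cyclo_1[simplified] monom_altdef one_pCons)
next
  case (Suc j)
  then have j: "j < k" by simp
  have "cyclo (N (Suc j)) * R (Suc j) = pcompose (cyclo (N j) * R j) (monom 1 (p j))"
    by (simp only: R.simps pcompose_mult mult.assoc[symmetric] cyclo_N_Suc[OF j])
  also have "cyclo (N j) * R j = - (monom 1 (N j) - 1)" using Suc by simp
  also have "pcompose \<dots> (monom 1 (p j)) = 1 - monom 1 (N (Suc j))"
    by (simp only: pcompose_uminus pcompose_monom_minus_one N_Suc) simp
  finally show ?case .
qed

lemma degree_cyclo_N_Suc:
  assumes "j < k"
  shows "degree (cyclo (N (Suc j))) + degree (cyclo (N j)) = degree (cyclo (N j)) * p j"
proof -
  have "degree (cyclo (N (Suc j)) * cyclo (N j)) = degree (cyclo (N j)) * p j"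
    unfolding cyclo_N_Suc[OF assms] by (simp add: degree_pcompose degree_monom_eq)
  then show ?thesis by (subst (asm) degree_mult_eq) auto
qed

lemma l1_norm_R_Suc_le: "l1_norm (R (Suc j)) \<le> cycS (N j) * l1_norm (R j)"
proof -
  have "l1_norm (R (Suc j)) \<le> l1_norm (cyclo (N j)) * l1_norm (pcompose (R j) (monom 1 (p j)))"
    by (simp add: l1_norm_mult_le)
  also have "\<dots> \<le> l1_norm (cyclo (N j)) * l1_norm (R j)"
    by (intro mult_left_mono l1_norm_pcompose_monom_le l1_norm_nonneg)
  finally show ?thesis by (simp add: cycS_eq_l1_norm)
qed

lemma l1_norm_R_0: "l1_norm (R 0) = 1"
  by (simp add: l1_norm_def)

text \<open>The factor 2 is \<open>cycS (N 0)\<close>, the norm of \<open>x - 1\<close>, split off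
  so that the product starts at 1.\<close>

lemma l1_norm_R_le: "l1_norm (R (Suc j)) \<le> 2 * (\<Prod>i=1..j. cycS (N i))"
proof (induction j)
  case 0
  have "cycS (N 0) = 2" by (simp add: cycS_eq_l1_norm cyclo_1[simplified] l1_norm_def)
  then show ?case using l1_norm_R_Suc_le[of 0] l1_norm_R_0 by (simp del: N_0 R.simps)
next
  case (Suc j)
  have "l1_norm (R (Suc (Suc j))) \<le> cycS (N (Suc j)) * l1_norm (R (Suc j))" by (rule l1_norm_R_Suc_le)
  also have "\<dots> \<le> cycS (N (Suc j)) * (2 * (\<Prod>i=1..j. cycS (N i)))"
    using Suc cycS_pos[of "N (Suc j)"] by (intro mult_left_mono) auto
  finally show ?case by (simp add: mult_ac)
qed

lemma fps_cyclo_mult_R_geom: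
  assumes "j \<le> k"
  shows "fps_of_poly (cyclo (N j)) * (fps_of_poly (R j) * geom_fps (N j)) = 1"
proof -
  have "fps_of_poly (cyclo (N j)) * (fps_of_poly (R j) * geom_fps (N j))
      = fps_of_poly (cyclo (N j) * R j) * geom_fps (N j)"
    by (simp add: fps_of_poly_mult mult.assoc)
  also have "fps_of_poly (cyclo (N j) * R j) = 1 - fps_X ^ N j"
    unfolding cyclo_mult_R[OF assms] by (simp add: fps_of_poly_diff fps_of_poly_monom)
  finally show ?thesis using geom_fps_mult N_pos[OF assms] by simp
qed

lemma inverse_cyclo_N:
  "j \<le> k \<Longrightarrow> inverse (fps_of_poly (cyclo (N j))) = fps_of_poly (R j) * geom_fps (N j)"
  by (intro fps_inverse_unique fps_cyclo_mult_R_geom)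

lemma fps_cyclo_N_Suc:
  assumes "j < k"
  shows "fps_of_poly (cyclo (N (Suc j))) =
    (fps_of_poly (pcompose (cyclo (N j)) (monom 1 (p j))) * geom_fps (N j)) * fps_of_poly (R j)"
proof -
  have "fps_of_poly (cyclo (N (Suc j)))
      = fps_of_poly (cyclo (N (Suc j))) * (fps_of_poly (cyclo (N j)) * (fps_of_poly (R j) * geom_fps (N j)))"
    using fps_cyclo_mult_R_geom[of j] assms by simp
  also have "\<dots> = fps_of_poly (cyclo (N (Suc j)) * cyclo (N j)) * geom_fps (N j) * fps_of_poly (R j)"
    by (simp only: fps_of_poly_mult mult_ac)
  finally show ?thesis by (simp only: cyclo_N_Suc[OF assms])
qed

text \<open>Young's inequality for the factorisation \<open>fps_cyclo_N_Suc\<close>. The case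
  \<open>j = 0\<close> is excluded because \<open>cyclo 1\<close> has degree 1, not below
  \<open>N 0 = 1\<close>.\<close>

lemma cycA_Suc_le:
  assumes "1 \<le> j" "j < k"
  shows "cycA (N (Suc j)) \<le> cycA (N j) * l1_norm (R j)"
proof (rule cycA_le)
  fix i
  have "coprime (p j) (N j)" using not_dvd_N prime_p assms prime_imp_coprime by blast
  moreover have "degree (cyclo (N j)) < N j" using N_gt_1 assms by (intro degree_cyclo_less) auto
  ultimately have "cmod (fps_nth (fps_of_poly (cyclo (N (Suc j)))) i) \<le> cycA (N j) * l1_norm (R j)"
    unfolding fps_cyclo_N_Suc[OF assms(2)]
    by (intro norm_fps_mult_poly_nth_le norm_stretch_geom_nth_le norm_coeff_cyclo_le_cycA)
  then show "cmod (coeff (cyclo (N (Suc j))) i) \<le> cycA (N j) * l1_norm (R j)" by simp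
qed

text \<open>With \<open>m = N j\<close> and \<open>n = N (Suc j)\<close>, the inverse is
  \<open>cyclo m / (1 - x^n)\<close> times the stretched \<open>R j\<close>. As
  \<open>cyclo m\<close> has degree below \<open>n\<close>, its copies in the first factor do not
  overlap.\<close>

lemma norm_inv_coeff_le:
  assumes "j < k"
  shows "cmod (inv_coeff (N (Suc j)) i) \<le> cycA (N j) * l1_norm (R j)"
proof -
  have "degree (cyclo (N j)) \<le> N j" by (rule degree_cyclo_le)
  also have "N j < N (Suc j)" using p_gt_1[OF assms] N_pos[of j] assms by simp
  finally have deg: "degree (cyclo (N j)) < N (Suc j)" .
  \<comment> \<open>The trivial substitution \<open>monom 1 1\<close> brings the factor into the
    form of \<open>norm_stretch_geom_nth_le\<close>.\<close>
  have "fps_of_poly (R (Suc j)) * geom_fps (N (Suc j))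
      = (fps_of_poly (pcompose (cyclo (N j)) (monom 1 1)) * geom_fps (N (Suc j)))
        * fps_of_poly (pcompose (R j) (monom 1 (p j)))"
    by (simp add: fps_of_poly_mult mult_ac monom_altdef)
  then have "cmod (inv_coeff (N (Suc j)) i)
      \<le> cycA (N j) * l1_norm (pcompose (R j) (monom 1 (p j)))"
    unfolding inv_coeff_def using inverse_cyclo_N[of "Suc j"] assms deg
    by (simp only: Suc_leI) (intro norm_fps_mult_poly_nth_le norm_stretch_geom_nth_le norm_coeff_cyclo_le_cycA, auto)
  also have "\<dots> \<le> cycA (N j) * l1_norm (R j)"
    using cycA_ge_1[of "N j"] by (intro mult_left_mono l1_norm_pcompose_monom_le) auto
  finally show ?thesis .
qed

text \<open>The coefficients of \<open>\<Phi>\<^sub>m\<close> are palindromic in modulus, so the weight counting the multiples of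
  \<open>m\<close> in the remaining degree range may be replaced by its average, which is at most \<open>p/2\<close>.\<close>

lemma cycS_Suc_le:
  assumes "j < k"
  shows "cycS (N (Suc j)) \<le> real (p j) / 2 * cycS (N j) * l1_norm (R j)"
proof -
  define m f D e where "m = N j" and "f = cyclo m" and "D = degree (cyclo (N (Suc j)))" and "e = degree f"
  define w where "w i = (real D - real (i * p j)) / real m + 1" for i
  have m: "m > 0" unfolding m_def using N_pos assms by simp
  have D: "D + e = e * p j" unfolding D_def e_def f_def m_def by (rule degree_cyclo_N_Suc[OF assms])
  have em: "e \<le> m" unfolding e_def f_def by (rule degree_cyclo_le)
  have Dr: "real D = real e * real (p j) - real e" using D by (metis add_diff_cancel_right' of_nat_add of_nat_mult)
  have pal: "cmod (coeff f (e - i)) = cmod (coeff f i)" if "i \<le> e" for i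
    using norm_coeff_cyclo_palindromic[OF m] that unfolding e_def f_def by blast
  \<comment> \<open>In the sum \<open>i\<close> cancels; with \<open>D = e (p - 1)\<close> it equals
    \<open>e (p - 2) / m + 2\<close>, and \<open>e \<le> m\<close>.\<close>
  have w: "w i + w (e - i) \<le> real (p j)" if "i \<le> e" for i
  proof -
    have "w i + w (e - i) = (2 * real D - real e * real (p j)) / real m + 2"
      using that by (simp add: w_def add_divide_distrib[symmetric] of_nat_diff algebra_simps)
    also have "2 * real D - real e * real (p j) = real e * (real (p j) - 2)"
      using Dr by (simp add: algebra_simps)
    also have "\<dots> / real m \<le> real m * (real (p j) - 2) / real m"
      using em p_gt_1[OF assms] by (intro divide_right_mono mult_right_mono) auto
    also have "\<dots> = real (p j) - 2" using m by simp
    finally show ?thesis by simp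
  qed
  let ?s = "\<Sum>i\<le>e. cmod (coeff f i) * w i"
  have "?s = (\<Sum>i\<le>e. cmod (coeff f (e - i)) * w (e - i))"
    by (rule sum.reindex_bij_witness[of _ "\<lambda>i. e - i" "\<lambda>i. e - i"]) auto
  also have "\<dots> = (\<Sum>i\<le>e. cmod (coeff f i) * w (e - i))"
    by (intro sum.cong) (auto simp: pal)
  finally have "2 * ?s = (\<Sum>i\<le>e. cmod (coeff f i) * (w i + w (e - i)))"
    by (simp add: sum.distrib distrib_left)
  also have "\<dots> \<le> (\<Sum>i\<le>e. cmod (coeff f i) * real (p j))"
    by (intro sum_mono mult_left_mono w) auto
  also have "\<dots> = cycS m * real (p j)"
    unfolding cycS_eq_l1_norm l1_norm_def sum_distrib_right by (simp add: f_def e_def)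
  finally have s: "?s \<le> real (p j) / 2 * cycS m" by (simp add: mult.commute)
  have "cycS (N (Suc j)) = (\<Sum>t\<le>D. cmod (fps_nth (fps_of_poly (cyclo (N (Suc j)))) t))"
    by (simp add: cycS_def cyc_coeff_def D_def)
  also have "\<dots> \<le> (\<Sum>t\<le>D. cmod (fps_nth (fps_of_poly (pcompose f (monom 1 (p j))) * geom_fps m) t)) * l1_norm (R j)"
    unfolding fps_cyclo_N_Suc[OF assms] f_def m_def by (rule sum_norm_fps_mult_poly_nth_le)
  also have "\<dots> \<le> ?s * l1_norm (R j)"
    unfolding w_def e_def using m D em
    by (intro mult_right_mono sum_norm_stretch_geom_nth_le l1_norm_nonneg) (auto simp: e_def)
  also have "\<dots> \<le> real (p j) / 2 * cycS m * l1_norm (R j)"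
    using s by (intro mult_right_mono l1_norm_nonneg)
  finally show ?thesis by (simp add: m_def)
qed


section \<open>Normalised sums and the squaring recursion\<close>

definition M :: "nat \<Rightarrow> real" where
  "M j = (\<Prod>i<j - 2. real (p i) ^ (2 ^ (j - i - 2) - 1))"

text \<open>The normalisation of \<open>cycS (N j)\<close>. By \<open>Q_rec\<close> it satisfies
  with equality the recursion that bounds \<open>cycS\<close>, so the primes cancel from the
  ratios.\<close>

definition Q :: "nat \<Rightarrow> real" where "Q j = M j * real (N j)"

definition T :: "nat \<Rightarrow> real" where "T j = (\<Prod>i=1..j. cycS (N i) / Q i)"

lemma M_pos: "j \<le> k \<Longrightarrow> M j > 0"
proof -
  assume "j \<le> k"
  have "0 < real (p i)" if "i \<in> {..<j - 2}" for i
  proof -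
    have "i < k" using that \<open>j \<le> k\<close> by auto
    then show ?thesis using p_gt_1[of i] by simp
  qed
  then show ?thesis unfolding M_def by (intro prod_pos) (metis zero_less_power)
qed

lemma Q_pos: "j \<le> k \<Longrightarrow> Q j > 0"
  unfolding Q_def using M_pos N_pos by simp

lemma M_1_2 [simp]: "M (Suc 0) = 1" "M (Suc (Suc 0)) = 1"
  by (simp_all add: M_def)

text \<open>Each exponent passes from \<open>2^a - 1\<close> to \<open>2 (2^a - 1) + 1\<close>:
  doubling gives the square, and the extra 1 gives one copy of each prime.\<close>

lemma M_Suc_Suc: "M (Suc (Suc j)) = (M (Suc j))\<^sup>2 * real (N j)"
proof (cases j)
  case (Suc i)
  have e: "2 ^ Suc a - 1 = 2 * (2 ^ a - 1) + (1 :: nat)" for a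
  proof -
    have "(1::nat) \<le> 2 ^ a" by simp
    then show ?thesis unfolding power_Suc by linarith
  qed
  have "M (Suc (Suc j)) = (\<Prod>l<i. real (p l) ^ (2 ^ Suc (Suc j - l - 2) - 1)) * real (p i)"
    unfolding M_def Suc by (simp add: Suc_diff_le less_imp_le)
  also have "(\<Prod>l<i. real (p l) ^ (2 ^ Suc (Suc j - l - 2) - 1))
      = (\<Prod>l<i. (real (p l) ^ (2 ^ (Suc j - l - 2) - 1))\<^sup>2 * real (p l))"
    unfolding e by (simp add: power_mult[symmetric] mult.commute)
  also have "\<dots> = (M (Suc j))\<^sup>2 * real (N i)"
    by (simp add: prod.distrib prod_power_distrib[symmetric] M_def Suc N_def)
  finally show ?thesis by (simp add: Suc)
qed simp

text \<open>One factor of the square in \<open>M_Suc_Suc\<close>, together with \<open>N j\<close>,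
  is the product of the \<open>Q i\<close>.\<close>

lemma M_rec: "M (Suc (Suc j)) = M (Suc j) * (\<Prod>i=1..j. Q i)"
proof (induction j)
  case (Suc j)
  have "M (Suc (Suc (Suc j))) = M (Suc (Suc j)) * (M (Suc (Suc j)) * real (N (Suc j)))"
    unfolding M_Suc_Suc[of "Suc j"] by (simp add: power2_eq_square)
  also have "M (Suc (Suc j)) * real (N (Suc j)) = (\<Prod>i=1..Suc j. Q i)"
    unfolding Suc.IH by (simp add: Q_def)
  finally show ?case .
qed simp

lemma Q_rec: "Q (Suc j) = real (p j) * (\<Prod>i=1..j. Q i)"
proof (cases j)
  case 0
  then show ?thesis by (simp add: Q_def)
next
  case (Suc i)
  have "Q (Suc (Suc i)) = M (Suc i) * (\<Prod>l=1..i. Q l) * real (N (Suc i)) * real (p (Suc i))"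
    unfolding Q_def[of "Suc (Suc i)"] M_rec by simp
  also have "\<dots> = real (p (Suc i)) * (\<Prod>l=1..Suc i. Q l)" by (simp add: Q_def)
  finally show ?thesis by (simp only: Suc)
qed

lemma T_pos: "j \<le> k \<Longrightarrow> T j > 0"
  unfolding T_def using Q_pos cycS_pos by (intro prod_pos) simp

lemma T_0 [simp]: "T 0 = 1" and T_Suc: "T (Suc j) = T j * (cycS (N (Suc j)) / Q (Suc j))"
  by (simp_all add: T_def)

lemma prod_Q_pos: "j \<le> k \<Longrightarrow> (\<Prod>i=1..j. Q i) > 0"
  using Q_pos by (intro prod_pos) simp

lemma T_mult_prod_Q: "j \<le> k \<Longrightarrow> T j * (\<Prod>i=1..j. Q i) = (\<Prod>i=1..j. cycS (N i))"
  using prod_Q_pos[of j] unfolding T_def prod_dividef by (simp del: prod_zero_iff)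

text \<open>The factor 2 from the norm of \<open>R j\<close> cancels the 1/2 gained by averaging in
  \<open>cycS_Suc_le\<close>; for \<open>j = 0\<close> the 2 comes from
  \<open>cycS 1 = 2\<close>.\<close>

lemma cycS_over_Q_le:
  assumes "j < k"
  shows "cycS (N (Suc j)) / Q (Suc j) \<le> T j"
proof -
  have "cycS (N j) * l1_norm (R j) \<le> 2 * (\<Prod>i=1..j. cycS (N i))"
  proof (cases j)
    case 0
    then show ?thesis by (simp add: l1_norm_R_0 del: R.simps) (simp add: cycS_eq_l1_norm cyclo_1[simplified] l1_norm_def)
  next
    case (Suc i)
    have "cycS (N j) * l1_norm (R j) \<le> cycS (N j) * (2 * (\<Prod>i=1..i. cycS (N i)))"
      unfolding Suc using l1_norm_R_le cycS_pos by (intro mult_left_mono) (auto simp: less_imp_le)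
    then show ?thesis by (simp add: Suc mult_ac)
  qed
  then have "real (p j) / 2 * (cycS (N j) * l1_norm (R j)) \<le> real (p j) / 2 * (2 * (\<Prod>i=1..j. cycS (N i)))"
    by (intro mult_left_mono) auto
  then have "cycS (N (Suc j)) \<le> real (p j) * (\<Prod>i=1..j. cycS (N i))"
    using cycS_Suc_le[OF assms] by (simp add: mult.assoc)
  also have "\<dots> = T j * Q (Suc j)"
    unfolding Q_rec using T_mult_prod_Q[of j] assms by simp
  finally show ?thesis using Q_pos[of "Suc j"] assms by (simp add: pos_divide_le_eq)
qed

lemma T_Suc_le: "j < k \<Longrightarrow> T (Suc j) \<le> (T j)\<^sup>2"
  unfolding T_Suc power2_eq_square using cycS_over_Q_le T_pos by (intro mult_left_mono) (auto simp: less_imp_le)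

lemma T_le_1: "j \<le> k \<Longrightarrow> T j \<le> 1"
proof (induction j)
  case (Suc j)
  then have "T (Suc j) \<le> (T j)\<^sup>2" using T_Suc_le by simp
  also have "\<dots> \<le> 1" using Suc T_pos[of j] by (intro power_le_one) auto
  finally show ?case .
qed simp

text \<open>The first gain over \<open>T j \<le> 1\<close>, supplied by the bound for two primes;
  repeated squaring amplifies it.\<close>

lemma T_2_le:
  assumes "2 \<le> k"
  shows "T 2 \<le> 1 / 2"
proof -
  have N2: "N 2 = p 0 * p 1" and Q2: "Q 2 = real (p 0) * real (p 1)"
    by (simp_all add: N_def Q_def M_def numeral_2_eq_2)
  have "p 0 \<noteq> p 1" using inj_onD[OF inj_p, of 0 1] assms by auto
  then have "cycS (N 2) \<le> Q 2 / 2"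
    unfolding N2 Q2 using cycS_two_primes_le prime_p assms by simp
  then have "cycS (N 2) / Q 2 \<le> 1 / 2" using Q_pos[OF assms] by (simp add: field_simps)
  moreover have "T 1 \<le> 1" "T 1 \<ge> 0" using T_le_1[of 1] T_pos[of 1] assms by auto
  ultimately have "T 1 * (cycS (N 2) / Q 2) \<le> 1 * (1 / 2)"
    using cycS_pos[of "N 2"] Q_pos[OF assms] by (intro mult_mono) auto
  then show ?thesis using T_Suc[of 1] by (simp add: numeral_2_eq_2)
qed

lemma T_le:
  assumes "cycS (N 3) / Q 3 \<le> d"
  shows "j + 3 \<le> k \<Longrightarrow> T (j + 3) \<le> (d / 2) ^ (2 ^ j)"
proof (induction j)
  case 0
  then have "T 2 * (cycS (N 3) / Q 3) \<le> 1 / 2 * d"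
    using assms T_2_le T_pos[of 2] cycS_pos[of "N 3"] Q_pos[of 3] by (intro mult_mono) auto
  then show ?case using T_Suc[of 2] by (simp add: numeral_3_eq_3 numeral_2_eq_2)
next
  case (Suc j)
  then have "T (Suc j + 3) \<le> (T (j + 3))\<^sup>2" using T_Suc_le[of "j + 3"] by simp
  also have "\<dots> \<le> ((d / 2) ^ (2 ^ j))\<^sup>2" using Suc T_pos[of "j + 3"] by (intro power_mono) auto
  finally show ?case by (simp add: power_mult[symmetric] mult.commute)
qed

text \<open>The numerator on the left bounds both the next \<open>cycA\<close> and the inverse
  coefficients, so one estimate serves both; \<open>M_rec\<close> turns the product of the
  \<open>cycS\<close> into \<open>T j\<close>.\<close>

lemma cycA_l1_norm_R_over_M_le:
  assumes "Suc j < k"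
  shows "cycA (N (Suc j)) * l1_norm (R (Suc j)) / M (Suc (Suc j)) \<le> 2 * (cycA (N (Suc j)) / M (Suc j)) * T j"
proof -
  have "cycA (N (Suc j)) * l1_norm (R (Suc j)) \<le> cycA (N (Suc j)) * (2 * (\<Prod>i=1..j. cycS (N i)))"
    using cycA_ge_1[of "N (Suc j)"] by (intro mult_left_mono l1_norm_R_le) auto
  also have "\<dots> = 2 * (cycA (N (Suc j)) / M (Suc j)) * T j * M (Suc (Suc j))"
    unfolding M_rec using T_mult_prod_Q[of j] M_pos[of "Suc j"] assms by (simp add: field_simps)
  finally show ?thesis using M_pos[of "Suc (Suc j)"] assms by (simp add: pos_divide_le_eq)
qed

lemma cycA_over_M_nonneg: "j \<le> k \<Longrightarrow> 0 \<le> cycA (N j) / M j"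
  using cycA_ge_1[of "N j"] M_pos[of j] by (intro divide_nonneg_pos) auto

lemma cycA_over_M_Suc_Suc_le:
  assumes "Suc j < k"
  shows "cycA (N (Suc (Suc j))) / M (Suc (Suc j)) \<le> 2 * (cycA (N (Suc j)) / M (Suc j)) * T j"
proof -
  have "cycA (N (Suc (Suc j))) / M (Suc (Suc j)) \<le> cycA (N (Suc j)) * l1_norm (R (Suc j)) / M (Suc (Suc j))"
    using M_pos[of "Suc (Suc j)"] assms by (intro divide_right_mono cycA_Suc_le) auto
  then show ?thesis using cycA_l1_norm_R_over_M_le[OF assms] by linarith
qed

text \<open>A crude bound using only \<open>T j \<le> 1\<close>; it starts the sharper induction and
  gives finiteness of suprema.\<close>

lemma cycA_over_M_le: "Suc j \<le> k \<Longrightarrow> cycA (N (Suc j)) / M (Suc j) \<le> 2 ^ Suc j"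
proof (induction j)
  case 0
  then show ?case using cycA_prime_le[OF prime_p[of 0]] by simp
next
  case (Suc j)
  have "0 \<le> cycA (N (Suc j)) / M (Suc j)" using cycA_over_M_nonneg[of "Suc j"] Suc.prems by simp
  moreover have "cycA (N (Suc j)) / M (Suc j) \<le> 2 ^ Suc j" using Suc by simp
  moreover have "T j \<le> 1" "0 \<le> T j" using Suc.prems T_le_1[of j] T_pos[of j] by auto
  ultimately have "2 * (cycA (N (Suc j)) / M (Suc j)) * T j \<le> 2 * 2 ^ Suc j * 1"
    by (intro mult_mono) auto
  then show ?case using cycA_over_M_Suc_Suc_le[of j] Suc.prems by simp
qed

text \<open>Each step contributes 2 and \<open>T (j + 3) \<le> (d/2)^(2^j)\<close>; the exponents
  add up to \<open>1 + 2 + ... + 2^(j-1) = 2^j - 1\<close>.\<close>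

lemma cycA_over_M_le_power:
  assumes "cycS (N 3) / Q 3 \<le> d" "0 \<le> d"
  shows "j + 4 \<le> k \<Longrightarrow> cycA (N (j + 4)) / M (j + 4) \<le> 2 ^ (j + 4) * (d / 2) ^ (2 ^ j - 1)"
proof (induction j)
  case 0
  then show ?case using cycA_over_M_le[of 3] by (simp add: numeral_eq_Suc)
next
  case (Suc j)
  have "cycA (N (Suc j + 4)) / M (Suc j + 4) \<le> 2 * (cycA (N (j + 4)) / M (j + 4)) * T (j + 3)"
    using cycA_over_M_Suc_Suc_le[of "j + 3"] Suc.prems by (simp add: numeral_eq_Suc)
  also have "\<dots> \<le> 2 * (2 ^ (j + 4) * (d / 2) ^ (2 ^ j - 1)) * (d / 2) ^ (2 ^ j)"
    using Suc T_le[OF assms(1), of j] T_pos[of "j + 3"] assms(2) cycA_over_M_nonneg[of "j + 4"]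
    by (intro mult_mono mult_nonneg_nonneg) auto
  also have "\<dots> = 2 ^ (Suc j + 4) * (d / 2) ^ (2 ^ Suc j - 1)"
  proof -
    have "2 ^ j - 1 + 2 ^ j = (2 ^ Suc j - 1 :: nat)" by simp
    then show ?thesis by (simp only: mult.assoc power_add[symmetric]) (simp add: power_add)
  qed
  finally show ?case .
qed

text \<open>A bound without \<open>d\<close>, valid from \<open>k = 1\<close> on, which makes the
  suprema in \<open>cycC\<close> and \<open>eps_inv\<close> finite.\<close>

lemma inv_coeff_le:
  assumes "1 \<le> k"
  shows "cmod (inv_coeff (N k) i) \<le> 2 ^ k * M k"
proof -
  obtain j where j: "k = Suc j" using assms by (cases k) auto
  have le: "cmod (inv_coeff (N k) i) \<le> cycA (N j) * l1_norm (R j)" using norm_inv_coeff_le[of j] j by simp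
  show ?thesis
  proof (cases j)
    case 0
    have "cycA (N 0) \<le> 1"
      by (intro cycA_le) (auto simp: cyclo_1[simplified] coeff_pCons split: nat.split)
    then show ?thesis using le l1_norm_R_0 by (simp add: j 0 del: R.simps)
  next
    case (Suc l)
    have "0 \<le> cycA (N (Suc l)) / M (Suc l)" using cycA_over_M_nonneg[of "Suc l"] Suc j by simp
    moreover have "T l \<le> 1" "0 \<le> T l" using T_le_1[of l] T_pos[of l] Suc j by auto
    ultimately have "2 * (cycA (N (Suc l)) / M (Suc l)) * T l \<le> 2 * 2 ^ Suc l * 1"
      using cycA_over_M_le[of l] Suc j by (intro mult_mono) auto
    then have "cycA (N j) * l1_norm (R j) / M k \<le> 2 ^ k"
      using cycA_l1_norm_R_over_M_le[of l] Suc j by simp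
    then have "cycA (N j) * l1_norm (R j) \<le> 2 ^ k * M k" using M_pos[of k] by (simp add: pos_divide_le_eq)
    then show ?thesis using le by linarith
  qed
qed

text \<open>The last step supplies one more factor \<open>T (l + 3)\<close>. As
  \<open>Suc l = k - 4\<close>, the exponent is \<open>2^k / 16 - 1\<close>, the origin of the 16th
  root of \<open>d/2\<close>.\<close>

lemma inv_coeff_le_power:
  assumes "cycS (N 3) / Q 3 \<le> d" "0 \<le> d" and k: "k = l + 5"
  shows "cmod (inv_coeff (N k) i) \<le> 2 ^ k * (d / 2) ^ (2 ^ Suc l - 1) * M k"
proof -
  have "cycA (N (l + 4)) * l1_norm (R (l + 4)) / M k \<le> 2 * (cycA (N (l + 4)) / M (l + 4)) * T (l + 3)"
    using cycA_l1_norm_R_over_M_le[of "l + 3"] k by (simp add: numeral_eq_Suc)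
  also have "\<dots> \<le> 2 * (2 ^ (l + 4) * (d / 2) ^ (2 ^ l - 1)) * (d / 2) ^ (2 ^ l)"
    using cycA_over_M_le_power[OF assms(1,2), of l] T_le[OF assms(1), of l] T_pos[of "l + 3"] assms(2) k
      cycA_over_M_nonneg[of "l + 4"]
    by (intro mult_mono mult_nonneg_nonneg) auto
  also have "\<dots> = 2 ^ k * (d / 2) ^ (2 ^ Suc l - 1)"
  proof -
    have "2 ^ l - 1 + 2 ^ l = (2 ^ Suc l - 1 :: nat)" by simp
    then show ?thesis by (simp only: mult.assoc power_add[symmetric]) (simp add: k power_add)
  qed
  finally have "cycA (N (l + 4)) * l1_norm (R (l + 4)) \<le> 2 ^ k * (d / 2) ^ (2 ^ Suc l - 1) * M k"
    using M_pos[of k] by (simp add: pos_divide_le_eq)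
  then show ?thesis using norm_inv_coeff_le[of "l + 4" i] k by (simp add: numeral_eq_Suc)
qed

end

subsection \<open>The constants and the asymptotic bound\<close>

lemma prime_seq_nth:
  assumes "ps \<in> odd_prime_lists k"
  shows "prime_seq ((!) ps) k"
proof
  show "prime (ps ! i)" if "i < k" for i
    using assms that unfolding odd_prime_lists_def by auto
  have "distinct ps" using assms unfolding odd_prime_lists_def by (simp add: strict_sorted_iff)
  then show "inj_on ((!) ps) {..<k}"
    using assms unfolding odd_prime_lists_def by (auto simp: inj_on_def nth_eq_iff_index_eq)
qed

lemma prod_list_eq_N:
  assumes "ps \<in> odd_prime_lists k"
  shows "prod_list ps = prime_seq.N ((!) ps) k"
  using assms unfolding prime_seq.N_def[OF prime_seq_nth[OF assms]] odd_prime_lists_def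
  by (auto simp: prod.list_conv_set_nth atLeast0LessThan)

lemma Mk_eq_M:
  assumes "ps \<in> odd_prime_lists k"
  shows "Mk k ps = prime_seq.M ((!) ps) k"
  unfolding prime_seq.M_def[OF prime_seq_nth[OF assms]] Mk_def by simp

section \<open>Numerical bounds for d, \<epsilon>_3, \<rho> and C\<close>

lemma triple_ratio_le:
  assumes "[p, q, r] \<in> odd_prime_lists 3"
  shows "cycS (p * q * r) / (real p ^ 2 * real q * real r) \<le> 1 / 2"
proof -
  interpret prime_seq "(!) [p, q, r]" 3 using assms by (rule prime_seq_nth)
  have "cycS (N (Suc 2)) / Q (Suc 2) \<le> T 2" by (rule cycS_over_Q_le) simp
  also have "\<dots> \<le> 1 / 2" by (rule T_2_le) simp
  also have "N (Suc 2) = p * q * r" by (simp add: numeral_2_eq_2)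
  also have "Q (Suc 2) = real p ^ 2 * real q * real r"
    by (simp add: Q_def M_def numeral_2_eq_2)
  finally show ?thesis .
qed

lemma odd_prime_triple_iff:
  "[p, q, r] \<in> odd_prime_lists 3 \<longleftrightarrow>
    (p, q, r) \<in> {(p, q, r). prime p \<and> prime q \<and> prime r \<and> odd p \<and> 2 < p \<and> p < q \<and> q < r}"
proof -
  have "2 < p" if "prime p" "odd p" using that prime_ge_2_nat[of p] by (cases "p = 2") auto
  moreover have "odd q" if "prime q" "2 < p" "p < q" using that by (intro prime_odd_nat) auto
  moreover have "odd r" if "prime r" "2 < p" "p < q" "q < r" using that by (intro prime_odd_nat) auto
  ultimately show ?thesis unfolding odd_prime_lists_def by auto
qed

definition odd_prime_triples :: "(nat \<times> nat \<times> nat) set" where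
  "odd_prime_triples = {(p, q, r). prime p \<and> prime q \<and> prime r \<and> odd p \<and> 2 < p \<and> p < q \<and> q < r}"

text \<open>Named so that the rules for suprema apply to \<open>dconst\<close> without matching on
  tuples.\<close>

definition triple_ratio :: "nat \<times> nat \<times> nat \<Rightarrow> real" where
  "triple_ratio = (\<lambda>(p, q, r). cycS (p * q * r) / (real p ^ 2 * real q * real r))"

lemma dconst_eq: "dconst = (SUP t\<in>odd_prime_triples. triple_ratio t)"
  unfolding dconst_def odd_prime_triples_def triple_ratio_def ..

lemma triple_ratio_le_half: "t \<in> odd_prime_triples \<Longrightarrow> triple_ratio t \<le> 1 / 2"
proof -
  assume t: "t \<in> odd_prime_triples"
  obtain p q r where [simp]: "t = (p, q, r)" by (cases t)
  have "[p, q, r] \<in> odd_prime_lists 3"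
    using t odd_prime_triple_iff[of p q r] unfolding odd_prime_triples_def by simp
  from triple_ratio_le[OF this] show ?thesis unfolding triple_ratio_def by simp
qed

lemma triple_ratio_le_dconst:
  assumes "[p, q, r] \<in> odd_prime_lists 3"
  shows "cycS (p * q * r) / (real p ^ 2 * real q * real r) \<le> dconst"
proof -
  have "(p, q, r) \<in> odd_prime_triples"
    using assms odd_prime_triple_iff[of p q r] unfolding odd_prime_triples_def by simp
  moreover have "bdd_above (triple_ratio ` odd_prime_triples)"
    by (rule bdd_aboveI2[OF triple_ratio_le_half])
  ultimately have "triple_ratio (p, q, r) \<le> dconst" unfolding dconst_eq by (rule cSUP_upper)
  then show ?thesis unfolding triple_ratio_def by simp
qed

lemma list_3_5_7: "[3, 5, 7] \<in> odd_prime_lists 3"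
  unfolding odd_prime_lists_def by simp

lemma dconst_le: "dconst \<le> 1 / 2"
  unfolding dconst_eq
proof (rule cSUP_least)
  have "(3, 5, 7) \<in> odd_prime_triples"
    using list_3_5_7 odd_prime_triple_iff[of 3 5 7] unfolding odd_prime_triples_def by simp
  then show "odd_prime_triples \<noteq> {}" by blast
qed (rule triple_ratio_le_half)

lemma dconst_pos: "dconst > 0"
proof -
  have "0 < cycS (3 * 5 * 7) / (real 3 ^ 2 * real 5 * real 7)" using cycS_pos by simp
  also have "\<dots> \<le> dconst" by (rule triple_ratio_le_dconst[OF list_3_5_7])
  finally show ?thesis .
qed

text \<open>The triple 3, 5, 7 has \<open>Mk = 3\<close>, and its \<open>cycA\<close> is at least 1
  because of the leading coefficient.\<close>

lemma eps_3_ge: "eps 3 \<ge> 1 / 3"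
proof -
  have "1 / 3 \<le> cycA (prod_list [3, 5, 7]) / Mk 3 [3, 5, 7]"
    using cycA_ge_1[of 105] by (simp add: Mk_def)
  also have "\<dots> \<le> eps 3"
    unfolding eps_def
  \<comment> \<open>The upper bound 8 is \<open>2^3\<close> from
    \<open>cycA_over_M_le\<close>.\<close>
  proof (rule cSUP_upper[OF list_3_5_7], rule bdd_aboveI2[of _ _ 8])
    fix ps assume ps: "ps \<in> odd_prime_lists 3"
    interpret prime_seq "(!) ps" 3 using ps by (rule prime_seq_nth)
    show "cycA (prod_list ps) / Mk 3 ps \<le> 8"
      unfolding prod_list_eq_N[OF ps] Mk_eq_M[OF ps] using cycA_over_M_le[of 2] by simp
  qed
  finally show ?thesis .
qed

text \<open>Every base is at least 5/6 and the exponents \<open>1 / 2^i\<close> sum to 2, whence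
  \<open>(5/6)^2\<close>. Logarithms turn the product into a series compared with a geometric
  one.\<close>

lemma rho_ge: "rho \<ge> 25 / 36"
proof -
  define g where "g i = ln ((2 * real i + 5) / (2 * real i + 6)) / 2 ^ i" for i :: nat
  have g: "ln (5 / 6) * (1 / 2) ^ i \<le> g i" "g i \<le> 0" for i
  proof -
    have "5 / 6 \<le> (2 * real i + 5) / (2 * real i + 6)" by (simp add: field_simps)
    then have "ln (5 / 6) \<le> ln ((2 * real i + 5) / (2 * real i + 6))" by (subst ln_le_cancel_iff) auto
    then have "ln (5 / 6) * (1 / 2 ^ i) \<le> ln ((2 * real i + 5) / (2 * real i + 6)) * (1 / 2 ^ i)"
      by (rule mult_right_mono) simp
    then show "ln (5 / 6) * (1 / 2) ^ i \<le> g i" by (simp add: g_def power_one_over)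
    have "ln ((2 * real i + 5) / (2 * real i + 6)) \<le> 0" by (simp add: field_simps)
    then show "g i \<le> 0" unfolding g_def by (simp add: divide_nonpos_pos)
  qed
  have sums: "(\<lambda>i. ln (5 / 6) * (1 / 2) ^ i) sums (ln (5 / 6) * 2 :: real)"
    using sums_mult[OF geometric_sums[of "1 / 2 :: real"], of "ln (5 / 6)"] by simp
  have summ: "summable g"
  proof (rule summable_comparison_test)
    show "\<exists>N. \<forall>n\<ge>N. norm (g n) \<le> - (ln (5 / 6) * (1 / 2) ^ n)" using g by (simp add: abs_le_iff)
    show "summable (\<lambda>n. - (ln (5 / 6 :: real) * (1 / 2) ^ n))"
      using sums by (intro summable_minus sums_summable)
  qed
  have "rho = (\<Prod>i. exp (g i))"
    unfolding rho_def g_def by (intro prodinf_cong) (simp add: powr_def)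
  also have "\<dots> = exp (suminf g)"
    by (rule prodinf_exp[OF summ])
  finally have rho: "rho = exp (suminf g)" .
  have "ln (5 / 6) * 2 \<le> suminf g"
    by (rule sums_le[OF _ sums summable_sums[OF summ]]) (rule g)
  then have "exp (ln (5 / 6) * 2) \<le> rho" unfolding rho by simp
  moreover have "exp (ln (5 / 6) * 2) = (25 / 36 :: real)"
    by (simp add: exp_double mult.commute[of _ 2] power2_eq_square)
  ultimately show ?thesis by simp
qed

text \<open>After taking 32nd powers the claim is
  \<open>d^2 / 4 \<le> (3/4) \<epsilon>_3^(3/2) d \<rho>^(1/4)\<close>. The left side is at most
  \<open>d / 8\<close>, the right at least \<open>(3/4) (4/21) (9/10) d = (9/70) d\<close>.\<close>

lemma dconst_powr_le_Cconst: "(dconst / 2) powr (1 / 16) \<le> Cconst"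
proof -
  have "sqrt (1 / 3) ^ 3 = 1 / 3 * sqrt (1 / 3)" by (simp add: power3_eq_cube)
  moreover have "(1 / 3) powr (3 / 2) = (sqrt (1 / 3) ^ 3 :: real)"
    by (simp add: powr_half_sqrt[symmetric] powr_powr flip: powr_realpow)
  \<comment> \<open>A rational bound just sharp enough: \<open>16/49 < 1/3\<close>.\<close>
  moreover have "sqrt (1 / 3) \<ge> 4 / 7" by (rule real_le_rsqrt) (simp add: power2_eq_square)
  ultimately have "4 / 21 \<le> (1 / 3 :: real) powr (3 / 2)" by simp
  also have "\<dots> \<le> eps 3 powr (3 / 2)" using eps_3_ge by (intro powr_mono2) auto
  finally have e: "4 / 21 \<le> eps 3 powr (3 / 2)" .
  have "((9 / 10) powr 4) powr (1 / 4) = (9 / 10 :: real)" unfolding powr_powr by simp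
  then have "9 / 10 = ((9 / 10) ^ 4) powr (1 / 4 :: real)" by simp
  also have "\<dots> \<le> rho powr (1 / 4)" using rho_ge by (intro powr_mono2) (auto simp: power4_eq_xxxx)
  finally have r: "9 / 10 \<le> rho powr (1 / 4)" .
  have d: "0 < dconst" "dconst \<le> 1 / 2" by (rule dconst_pos dconst_le)+
  have "(dconst / 2)\<^sup>2 = dconst / 4 * dconst" by (simp add: power2_eq_square)
  also have "\<dots> \<le> 1 / 8 * dconst" using d by (intro mult_right_mono) auto
  also have "\<dots> \<le> 3 / 4 * (4 / 21) * dconst * (9 / 10)" using d by simp
  also have "\<dots> \<le> 3 / 4 * eps 3 powr (3 / 2) * dconst * rho powr (1 / 4)"
    using e r d by (intro mult_mono) auto
  finally have "(dconst / 2)\<^sup>2 powr (1 / 32) \<le> Cconst"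
    unfolding Cconst_def by (intro powr_mono2) auto
  moreover have "((dconst / 2) powr 2) powr (1 / 32) = (dconst / 2) powr (1 / 16)"
    unfolding powr_powr by simp
  moreover have "(dconst / 2) powr 2 = (dconst / 2)\<^sup>2" using d by simp
  ultimately show ?thesis by simp
qed

section \<open>Bounds for \<epsilon>_k^inv and passage to the limit\<close>

lemma odd_prime_lists_nonempty: "odd_prime_lists k \<noteq> {}"
proof -
  have "infinite ({p::nat. prime p} - {2})" using primes_infinite by simp
  then obtain A where A: "finite A" "card A = k" "A \<subseteq> {p::nat. prime p} - {2}"
    using infinite_arbitrarily_large by blast
  then have "sorted_list_of_set A \<in> odd_prime_lists k"
    unfolding odd_prime_lists_def using prime_odd_nat prime_ge_2_nat
    by (auto simp: strict_sorted_list_of_set) (metis DiffD2 insertI1 mem_Collect_eq primes_dvd_imp_eq subsetD two_is_prime_nat DiffD1)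
  then show ?thesis by blast
qed

lemma cycC_over_Mk_le:
  assumes ps: "ps \<in> odd_prime_lists k" and "k \<ge> 1"
  shows "cycC (prod_list ps) / Mk k ps \<le> 2 ^ k"
    and "0 < cycC (prod_list ps) / Mk k ps"
    and "k = l + 5 \<Longrightarrow> cycC (prod_list ps) / Mk k ps \<le> 2 ^ k * (dconst / 2) ^ (2 ^ Suc l - 1)"
proof -
  interpret prime_seq "(!) ps" k using ps by (rule prime_seq_nth)
  have M: "Mk k ps = M k" "prod_list ps = N k" using Mk_eq_M prod_list_eq_N ps by auto
  have Mp: "M k > 0" by (rule M_pos) simp
  have bdd: "bdd_above (range (\<lambda>m. cmod (inv_coeff (N k) m)))"
    using inv_coeff_le[OF \<open>k \<ge> 1\<close>] by (intro bdd_aboveI2)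
  have "cycC (N k) \<le> 2 ^ k * M k"
    unfolding cycC_def using inv_coeff_le[OF \<open>k \<ge> 1\<close>] by (intro cSUP_least) auto
  then show "cycC (prod_list ps) / Mk k ps \<le> 2 ^ k" using Mp M by (simp add: pos_divide_le_eq)
  \<comment> \<open>Positivity: comparing constant terms shows that \<open>inv_coeff (N k) 0\<close>
    is nonzero.\<close>
  have "fps_of_poly (cyclo (N k)) * inverse (fps_of_poly (cyclo (N k))) = 1"
    using fps_cyclo_mult_R_geom[of k] inverse_cyclo_N[of k] by simp
  then have "fps_nth (fps_of_poly (cyclo (N k)) * inverse (fps_of_poly (cyclo (N k)))) 0 = 1" by simp
  then have "inv_coeff (N k) 0 \<noteq> 0" unfolding inv_coeff_def by auto
  then have "0 < cmod (inv_coeff (N k) 0)" by simp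
  also have "\<dots> \<le> cycC (N k)" unfolding cycC_def by (rule cSUP_upper[OF UNIV_I bdd])
  finally show "0 < cycC (prod_list ps) / Mk k ps" using Mp M by simp
  assume k: "k = l + 5"
  define p q r where "p = ps ! 0" and "q = ps ! 1" and "r = ps ! 2"
  have "take 3 ps = [p, q, r]"
    using ps k unfolding odd_prime_lists_def p_def q_def r_def
    by (intro nth_equalityI) (auto simp: less_Suc_eq numeral_eq_Suc)
  moreover have "take 3 ps \<in> odd_prime_lists 3"
    using ps k unfolding odd_prime_lists_def by (auto simp: sorted_wrt_take dest: in_set_takeD)
  ultimately have "cycS (p * q * r) / (real p ^ 2 * real q * real r) \<le> dconst"
    using triple_ratio_le_dconst by simp
  also have "p * q * r = N 3" by (simp add: N_def p_def q_def r_def numeral_eq_Suc)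
  also have "real p ^ 2 * real q * real r = Q 3"
    by (simp add: Q_def M_def N_def p_def q_def r_def numeral_eq_Suc)
  finally have "cmod (inv_coeff (N k) i) \<le> 2 ^ k * (dconst / 2) ^ (2 ^ Suc l - 1) * M k" for i
    using inv_coeff_le_power[OF _ _ k] dconst_pos by simp
  then have "cycC (N k) \<le> 2 ^ k * (dconst / 2) ^ (2 ^ Suc l - 1) * M k"
    unfolding cycC_def by (intro cSUP_least) auto
  then show "cycC (prod_list ps) / Mk k ps \<le> 2 ^ k * (dconst / 2) ^ (2 ^ Suc l - 1)"
    using Mp M by (simp add: pos_divide_le_eq)
qed

lemma eps_inv_pos:
  assumes "k \<ge> 1"
  shows "eps_inv k > 0"
proof -
  obtain ps where ps: "ps \<in> odd_prime_lists k" using odd_prime_lists_nonempty by blast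
  have "bdd_above ((\<lambda>ps. cycC (prod_list ps) / Mk k ps) ` odd_prime_lists k)"
    using cycC_over_Mk_le(1) assms by (intro bdd_aboveI2)
  then have "cycC (prod_list ps) / Mk k ps \<le> eps_inv k"
    unfolding eps_inv_def using ps by (rule cSUP_upper[rotated])
  then show ?thesis using cycC_over_Mk_le(2)[OF ps assms] by linarith
qed

lemma eps_inv_le: "eps_inv (l + 5) \<le> 2 ^ (l + 5) * (dconst / 2) ^ (2 ^ Suc l - 1)"
  unfolding eps_inv_def
  by (rule cSUP_least[OF odd_prime_lists_nonempty], rule cycC_over_Mk_le(3)) simp_all

text \<open>With \<open>x = d/2\<close> and \<open>k = l + 5\<close>, the logarithm of
  \<open>2^k x^(2^k/16 - 1)\<close> divided by \<open>2^k\<close> is \<open>(ln x) / 16\<close> plus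
  a remainder that tends to 0.\<close>

lemma eps_inv_root_le:
  "eps_inv (l + 5) powr (1 / 2 ^ (l + 5)) \<le>
    exp ((real (l + 5) * ln 2 - ln (dconst / 2)) / 2 ^ (l + 5)) * (dconst / 2) powr (1 / 16)"
proof -
  define x where "x = dconst / 2"
  have x: "x > 0" unfolding x_def using dconst_pos by simp
  have "eps_inv (l + 5) powr (1 / 2 ^ (l + 5)) \<le> (2 ^ (l + 5) * x ^ (2 ^ Suc l - 1)) powr (1 / 2 ^ (l + 5))"
    using eps_inv_pos[of "l + 5"] eps_inv_le[of l] unfolding x_def by (intro powr_mono2) auto
  also have "\<dots> = exp (1 / 2 ^ (l + 5) * ln (2 ^ (l + 5) * x ^ (2 ^ Suc l - 1)))"
    using x by (simp add: powr_def)
  also have "ln (2 ^ (l + 5) * x ^ (2 ^ Suc l - 1)) = real (l + 5) * ln 2 + (2 ^ Suc l - 1) * ln x"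
    using x by (subst ln_mult_pos) (auto simp: ln_realpow of_nat_diff)
  also have "1 / 2 ^ (l + 5) * \<dots> = (real (l + 5) * ln 2 - ln x) / 2 ^ (l + 5) + 1 / 16 * ln x"
    by (simp add: power_add field_simps)
  also have "exp \<dots> = exp ((real (l + 5) * ln 2 - ln x) / 2 ^ (l + 5)) * x powr (1 / 16)"
    unfolding exp_add using x by (simp add: powr_def)
  finally show ?thesis unfolding x_def .
qed

theorem theorem2:
  shows "\<exists>\<delta> :: nat \<Rightarrow> real. \<delta> \<longlonglongrightarrow> 0 \<and>
           (\<forall>k\<ge>1. ln (eps_inv k) \<le> 2 ^ k * ln (Cconst + \<delta> k))"
proof (intro exI conjI allI impI)
  define x where "x = dconst / 2"
  \<comment> \<open>With this choice \<open>Cconst + ?\<delta> k\<close> is the larger of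
    \<open>Cconst\<close> and the \<open>2^k\<close>-th root, so the inequality is immediate and
    only convergence needs the estimates.\<close>
  let ?\<delta> = "\<lambda>k. max 0 (eps_inv k powr (1 / 2 ^ k) - Cconst)"
  \<comment> \<open>Majorises \<open>?\<delta> k\<close> for \<open>k \<ge> 5\<close>: the root is
    replaced by its upper bound and \<open>Cconst\<close> by the smaller
    \<open>x powr (1 / 16)\<close>.\<close>
  let ?b = "\<lambda>k. max 0 (exp ((real k * ln 2 - ln x) / 2 ^ k) * x powr (1 / 16) - x powr (1 / 16))"
  have "(\<lambda>k. (real k * ln 2 - c) / 2 ^ k) \<longlonglongrightarrow> 0" for c :: real by real_asymp
  then have "?b \<longlonglongrightarrow> max 0 (exp 0 * x powr (1 / 16) - x powr (1 / 16))"
    by (intro tendsto_intros)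
  then have b: "?b \<longlonglongrightarrow> 0" by simp
  show "?\<delta> \<longlonglongrightarrow> 0"
  proof (rule tendsto_sandwich[OF _ _ tendsto_const b])
    show "\<forall>\<^sub>F k in sequentially. ?\<delta> k \<le> ?b k"
    proof (rule eventually_sequentiallyI[of 5])
      fix k :: nat assume "5 \<le> k"
      then obtain l where "k = l + 5" by (metis add.commute le_Suc_ex)
      then show "?\<delta> k \<le> ?b k"
        using eps_inv_root_le[of l] dconst_powr_le_Cconst unfolding x_def by auto
    qed
  qed simp
  fix k :: nat assume "k \<ge> 1"
  then have pos: "eps_inv k > 0" by (rule eps_inv_pos)
  have "ln (eps_inv k) = 2 ^ k * ln (eps_inv k powr (1 / 2 ^ k))"
    using pos by (simp add: ln_powr)
  also have "\<dots> \<le> 2 ^ k * ln (Cconst + ?\<delta> k)"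
    using pos by (intro mult_left_mono ln_mono) auto
  finally show "ln (eps_inv k) \<le> 2 ^ k * ln (Cconst + ?\<delta> k)" .
qed

end
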